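(* Let $d\ge 2$, let $\mathbb{F}_q$ be a finite field with $q$ elements, $F=\mathbb{F}_q((1/t))$, $\mathcal{O}=\mathbb{F}_q[[1/t]]$, and let $\Gamma=\mathrm{PGL}_d(\mathbb{F}_q[t])$. For $\bar n=(n_1,\dots,n_d)\in\mathbb{Z}^d$ with $n_1\ge\cdots\ge n_d=0$ let $\Gamma_{\bar n}$ be the stabilizer in $\Gamma$ of the vertex $[l_{\bar n}]$ of the Bruhat–Tits building of $\mathrm{PGL}_d(F)$. Then the total weight $$w(T)=\sum_{\bar n:\ n_1\ge\cdots\ge n_d=0}\frac{1}{|\Gamma_{\bar n}|}$$ is finite, and $$w(T)=(q-1)\sum_{(d_1,\dots,d_r)}\left(\frac{1}{\prod_{i=1}^r|\mathrm{GL}_{d_i}(\mathbb{F}_q)|}\;q^{-\sum_{1\le i<j\le r}d_id_j}\;\prod_{l=1}^{r-1}\frac{-q^{-\sum_{i=1}^{l}\sum_{j=l+1}^{r}d_id_j}}{q^{-\sum_{i=1}^{l}\sum_{j=l+1}^{r}d_id_j}-1}\right),$$ where the outer sum is over all ordered tuples $(d_1,\dots,d_r)$ of positive integers (with $r\ge1$ arbitrary) such that $d_1+\cdots+d_r=d$.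
   Context: A lattice in $F^d$ is a finitely generated $\mathcal{O}$-submodule of $F^d$ that spans $F^d$ over $F$. Two lattices $L,L'$ are equivalent if $L'=aL$ for some $a\in F^\times$; $[L]$ denotes the equivalence class. The vertices of the Bruhat–Tits building of $\mathrm{PGL}_d(F)$ are the equivalence classes of lattices, on which $\mathrm{PGL}_d(F)$ acts by $g[L]=[gL]$. For $\bar n=(n_1,\dots,n_d)$ with $n_1\ge\cdots\ge n_d=0$, $l_{\bar n}=\sum_{i=1}^d t^{n_i}\mathcal{O}e_i$, where $e_1,\dots,e_d$ is the standard basis of $F^d$, and $T$ is the set of all vertices $[l_{\bar n}]$ of this form. The weight of the vertex $[l_{\bar n}]$ is $1/|\Gamma_{\bar n}|$; $w(T)$ is the covolume of $\Gamma$. *)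

theory Defs
  imports
    "HOL-Library.Cardinality"
    "HOL-Analysis.Infinite_Sum"
    "HOL-Computational_Algebra.Formal_Laurent_Series"
    "Jordan_Normal_Form.VS_Connect"
begin

text \<open>
  The finite field is the type \<^typ>\<open>'a\<close>. The Laurent series variable \<^term>\<open>fls_X\<close> stands
  for \<open>1/t\<close>, so \<open>F = F_q((1/t))\<close> is the type \<open>'a fls\<close>, \<open>t\<close> is \<^term>\<open>fls_X_inv\<close>, and
  \<open>\<O> = F_q[[1/t]]\<close> is the range of \<^term>\<open>fps_to_fls\<close>.
\<close>

definition O_ring :: "'a::field fls ring" where
  "O_ring = class_ring\<lparr>carrier := range fps_to_fls\<rparr>"

definition O_span :: "nat \<Rightarrow> 'a::field fls vec set \<Rightarrow> 'a fls vec set" where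
  "O_span d S = LinearCombinations.module.span O_ring (module_vec TYPE('a fls) d) S"

definition F_span :: "nat \<Rightarrow> 'a::field fls vec set \<Rightarrow> 'a fls vec set" where
  "F_span d S = LinearCombinations.module.span class_ring (module_vec TYPE('a fls) d) S"

definition is_lattice :: "nat \<Rightarrow> 'a::field fls vec set \<Rightarrow> bool" where
  "is_lattice d L \<longleftrightarrow>
     (\<exists>S. finite S \<and> S \<subseteq> carrier_vec d \<and> L = O_span d S) \<and> F_span d L = carrier_vec d"

definition lattice_equiv :: "nat \<Rightarrow> ('a::field fls vec set \<times> 'a fls vec set) set" where
  "lattice_equiv d =
     {(L, L'). is_lattice d L \<and> is_lattice d L' \<and> (\<exists>a. a \<noteq> 0 \<and> L' = (\<lambda>v. a \<cdot>\<^sub>v v) ` L)}"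

definition lattice_class :: "nat \<Rightarrow> 'a::field fls vec set \<Rightarrow> 'a fls vec set set" where
  "lattice_class d L = lattice_equiv d `` {L}"

definition standard_lattice :: "nat \<Rightarrow> int list \<Rightarrow> 'a::field fls vec set" where
  "standard_lattice d ns =
     O_span d ((\<lambda>i. (fls_X_inv powi (ns ! i)) \<cdot>\<^sub>v unit_vec d i) ` {..<d})"

definition GL :: "nat \<Rightarrow> 'r::comm_ring_1 mat monoid" where
  "GL d = units_of (ring_mat TYPE('r) d ())"

definition scalars :: "nat \<Rightarrow> 'r::comm_ring_1 mat set" where
  "scalars d = {a \<cdot>\<^sub>m 1\<^sub>m d | a. a dvd 1}"

definition PGL :: "nat \<Rightarrow> 'r::comm_ring_1 mat set monoid" where
  "PGL d = GL d Mod scalars d"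

text \<open>
  An element of \<open>PGL_d(F)\<close> is a coset \<open>C\<close> of matrices and a vertex \<open>V\<close> a class of lattices;
  the elementwise action below sends \<open>V = [L]\<close> to \<open>[gL]\<close> for every \<open>g \<in> C\<close>.
\<close>

definition PGL_act :: "'a::field fls mat set \<Rightarrow> 'a fls vec set set \<Rightarrow> 'a fls vec set set" where
  "PGL_act C V = {(\<lambda>v. g *\<^sub>v v) ` L | g L. g \<in> C \<and> L \<in> V}"

definition poly_to_F :: "'a::field poly \<Rightarrow> 'a fls" where
  "poly_to_F p = poly (map_poly fls_const p) fls_X_inv"

text \<open>The homomorphism \<open>PGL_d(F_q[t]) \<rightarrow> PGL_d(F)\<close> induced by the inclusion \<open>F_q[t] \<subseteq> F\<close>.\<close>

definition PGL_poly_to_F :: "nat \<Rightarrow> 'a::field poly mat set \<Rightarrow> 'a fls mat set" where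
  "PGL_poly_to_F d C = scalars d <#>\<^bsub>GL d\<^esub> (map_mat poly_to_F ` C)"

definition vertex_stabilizer ::
    "nat \<Rightarrow> 'a::field fls vec set set \<Rightarrow> 'a poly mat set set" where
  "vertex_stabilizer d V = {C \<in> carrier (PGL d). PGL_act (PGL_poly_to_F d C) V = V}"

definition \<Gamma>_stab :: "nat \<Rightarrow> int list \<Rightarrow> 'a::field poly mat set set" where
  "\<Gamma>_stab d ns = vertex_stabilizer d (lattice_class d (standard_lattice d ns))"

definition sector_indices :: "nat \<Rightarrow> int list set" where
  "sector_indices d = {ns. length ns = d \<and> sorted_wrt (\<ge>) ns \<and> last ns = 0}"

definition compositions :: "nat \<Rightarrow> nat list set" where
  "compositions d = {ds. (\<forall>k\<in>set ds. 0 < k) \<and> sum_list ds = d}"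

text \<open>The sum of the \<open>d_i d_j\<close> over \<open>1 \<le> i \<le> l < j \<le> r\<close>; list positions start at \<open>0\<close>.\<close>

definition cut_sum :: "nat list \<Rightarrow> nat \<Rightarrow> nat" where
  "cut_sum ds l = (\<Sum>i<l. \<Sum>j=l..<length ds. ds ! i * ds ! j)"

end

theory Submission
  imports Defs "Jordan_Normal_Form.Char_Poly" "HOL-Algebra.Coset"
    "HOL-Analysis.Elementary_Metric_Spaces"
begin

text \<open>
  A matrix \<open>g\<close> in \<open>GL_d(F_q[t])\<close> has a constant determinant, so it can send \<open>l_n\<close> to a multiple of
  itself only if it fixes \<open>l_n\<close>, which means that every nonzero entry \<open>g_ij\<close> has degree at most
  \<open>n_i - n_j\<close>. Grouping equal \<open>n_i\<close> into blocks, these matrices are block upper triangular with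
  constant invertible diagonal blocks and can be counted; dividing by the \<open>q - 1\<close> scalars gives the
  order of the stabilizer.

  For the sum over the sector, the last block (of size \<open>k\<close>, where \<open>n_i = 0\<close>) is split off together
  with the gap before it. This multiplies the weight by a factor that depends on the remaining indices
  only through their sum, so the sums \<open>\<Sum> q^(-c (n_1 + \<dots> + n_d)) w(n)\<close>, for all \<open>c\<close> at once, satisfy
  a recursion in which \<open>c\<close> becomes \<open>c + k\<close> and the gap contributes a geometric series with ratio
  \<open>q^(-(d - k)(c + k))\<close>.
\<close>

subsection \<open>Diagonal lattices\<close>

no_notation fps_nth (infixl \<open>$\<close> 75)
no_notation fls_nth (infixl \<open>$$\<close> 75)

text \<open>For nonzero \<open>c i\<close> this is the free \<O>-module on the vectors c_i e_i. In
  coordinates, membership becomes a test on valuations and rescaling only changes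
  \<open>c\<close>.\<close>

definition diag_lattice :: "nat \<Rightarrow> (nat \<Rightarrow> 'a::field fls) \<Rightarrow> 'a fls vec set" where
  "diag_lattice d c = {v \<in> carrier_vec d. \<forall>i<d. v $ i / c i \<in> range fps_to_fls}"

section \<open>The valuation ring \<O> and its action on F^d\<close>

lemma range_fps_to_fls_iff: "x \<in> range fps_to_fls \<longleftrightarrow> 0 \<le> fls_subdegree x"
proof
  assume "0 \<le> fls_subdegree x"
  hence "fps_to_fls (fls_regpart x) = x" by (simp add: fls_regpart_to_fls_trivial)
  thus "x \<in> range fps_to_fls" by (metis rangeI)
qed (auto simp: fls_subdegree_fls_to_fps_gt0)

lemma range_fps_to_fls_mult:
  "x \<in> range fps_to_fls \<Longrightarrow> y \<in> range fps_to_fls \<Longrightarrow> x * y \<in> range (fps_to_fls :: 'a::field fps \<Rightarrow> _)"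
  by (auto simp: fls_times_fps_to_fls[symmetric])

lemma range_fps_to_fls_sum:
  "(\<And>i. i \<in> A \<Longrightarrow> f i \<in> range fps_to_fls) \<Longrightarrow> sum f A \<in> range (fps_to_fls :: 'a::field fps \<Rightarrow> _)"
proof (induction A rule: infinite_finite_induct)
  case (insert x F)
  then obtain a b where "f x = fps_to_fls a" "sum f F = fps_to_fls b" by blast
  hence "sum f (insert x F) = fps_to_fls (a + b)" using insert by simp
  thus ?case by blast
qed (auto intro: range_eqI[of _ _ 0])

lemma fls_subdegree_X_inv_powi: "fls_subdegree (fls_X_inv powi n :: 'a::field fls) = - n"
  by (simp add: fls_subdegree_power_int)

text \<open>\<open>O_span\<close> pairs the ring \<O> with the module record built for scalars in F.
  That this pair is a module gives access to the description of its spans by linear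
  combinations.\<close>

lemma module_O_ring: "Module.module (O_ring :: 'a::field fls ring) (module_vec TYPE('a fls) d)"
proof -
  interpret vec_space "TYPE('a fls)" d .
  have [simp]: "0 \<in> range (fps_to_fls :: 'a fps \<Rightarrow> _)" "1 \<in> range (fps_to_fls :: 'a fps \<Rightarrow> _)"
    by (auto intro: range_eqI[of _ _ 0] range_eqI[of _ _ 1])
  have [simp]: "x + y \<in> range fps_to_fls" if "x \<in> range fps_to_fls" "y \<in> range fps_to_fls" for x y :: "'a fls"
    using that by (auto simp flip: fps_to_fls_plus)
  have neg: "\<exists>y\<in>range fps_to_fls. y + x = 0 \<and> x + y = 0" if "x \<in> range fps_to_fls" for x :: "'a fls"
    using that by (intro bexI[of _ "- x"]) (auto simp flip: fps_to_fls_uminus)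
  have "cring (O_ring :: 'a fls ring)"
    by unfold_locales (use neg in \<open>auto simp: O_ring_def Units_def field_simps intro: range_fps_to_fls_mult\<close>)
  moreover have "abelian_group (module_vec TYPE('a fls) d)" by (rule abelian_group_axioms)
  ultimately show ?thesis
    by (intro module.intro module_axioms.intro)
       (auto simp: O_ring_def module_vec_simps add_smult_distrib_vec smult_add_distrib_vec)
qed

text \<open>The generators of a diagonal lattice are pairwise distinct because the \<open>c i\<close> are nonzero,
  so a linear combination of them can be specified coordinate by coordinate.\<close>

context
  fixes d :: nat and c :: "nat \<Rightarrow> 'a::field fls"
  assumes c: "\<And>i. i < d \<Longrightarrow> c i \<noteq> 0"
begin

no_notation fps_nth (infixl \<open>$\<close> 75)
no_notation fls_nth (infixl \<open>$$\<close> 75)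

abbreviation (input) "gens \<equiv> (\<lambda>i. c i \<cdot>\<^sub>v unit_vec d i) ` {..<d}"

lemma inj_on_gens: "inj_on (\<lambda>i. c i \<cdot>\<^sub>v unit_vec d i) {..<d}"
proof (rule inj_onI)
  fix i j assume ij: "i \<in> {..<d}" "j \<in> {..<d}" and eq: "c i \<cdot>\<^sub>v unit_vec d i = c j \<cdot>\<^sub>v unit_vec d j"
  have "(c i \<cdot>\<^sub>v unit_vec d i) $ i = (c j \<cdot>\<^sub>v unit_vec d j) $ i" using eq by simp
  thus "i = j" using ij c[of i] by (auto simp: unit_vec_def split: if_splits)
qed

text \<open>Coefficients belong to vectors rather than to indices, so \<open>a\<close> is prescribed
  at the generators. Coordinate \<open>i\<close> receives a contribution from the
  \<open>i\<close>-th generator only.\<close>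

lemma lincomb_gens:
  assumes "v \<in> carrier_vec d" "\<And>i. i < d \<Longrightarrow> a (c i \<cdot>\<^sub>v unit_vec d i) = v $ i / c i"
  shows "LinearCombinations.module.lincomb (module_vec TYPE('a fls) d) a gens = v"
proof -
  interpret vec_space "TYPE('a fls)" d .
  have gc: "gens \<subseteq> carrier_vec d" by auto
  show ?thesis
  proof (rule eq_vecI)
    show "dim_vec (lincomb a gens) = dim_vec v"
      using lincomb_closed[OF gc, of a] assms(1) by auto
  next
    fix i assume "i < dim_vec v"
    hence i: "i < d" using assms(1) by auto
    have "lincomb a gens $ i = (\<Sum>x\<in>gens. a x * x $ i)"
      by (rule lincomb_index[OF i gc])
    also have "\<dots> = (\<Sum>j<d. v $ j / c j * (c j * (if i = j then 1 else 0)))"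
      by (subst sum.reindex[OF inj_on_gens]) (auto intro!: sum.cong simp: assms i)
    also have "\<dots> = (\<Sum>j<d. if i = j then v $ j else 0)"
      by (rule sum.cong) (use c in auto)
    also have "\<dots> = v $ i" using i by simp
    finally show "lincomb a gens $ i = v $ i" .
  qed
qed

text \<open>The quotients of a generator are 0 or 1, so integral combinations stay in the set.
  Conversely, the quotients v_i / c_i are themselves the coefficients.\<close>

lemma O_span_gens: "O_span d gens = diag_lattice d c"
proof -
  interpret vec_space "TYPE('a fls)" d .
  have O: "range (fps_to_fls :: 'a fps \<Rightarrow> _) = carrier O_ring" by (simp add: O_ring_def)
  interpret om: Module.module "O_ring :: 'a fls ring" "module_vec TYPE('a fls) d"
    using module_O_ring .
  show ?thesis
  proof (intro equalityI subsetI)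
    fix v assume "v \<in> O_span d gens"
    \<comment> \<open>A linear combination depends only on the module record, so one over \<O> can
      be evaluated with the vector space lemmas over F.\<close>
    then obtain a A where A: "A \<subseteq> gens" "finite A" "a \<in> A \<rightarrow> range fps_to_fls" "v = lincomb a A"
      unfolding O_span_def om.span_def O by blast
    have Ac: "A \<subseteq> carrier_vec d" using A(1) by auto
    have "v $ i / c i \<in> range fps_to_fls" if "i < d" for i
    proof -
      have "v $ i / c i = (\<Sum>x\<in>A. a x * (x $ i / c i))"
        using lincomb_index[OF that Ac] by (simp add: A sum_divide_distrib)
      also have "\<dots> \<in> range fps_to_fls"
      proof (intro range_fps_to_fls_sum range_fps_to_fls_mult)
        fix x assume x: "x \<in> A"
        then obtain j where "j < d" "x = c j \<cdot>\<^sub>v unit_vec d j" using A(1) by auto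
        thus "x $ i / c i \<in> range fps_to_fls"
          using that c[of i] by (auto intro: range_eqI[of _ _ 0] range_eqI[of _ _ 1])
        show "a x \<in> range fps_to_fls" using A x by blast
      qed
      finally show ?thesis .
    qed
    moreover have "v \<in> carrier_vec d" using A lincomb_closed[OF Ac] by simp
    ultimately show "v \<in> diag_lattice d c" by (simp add: diag_lattice_def)
  next
    fix v assume v: "v \<in> diag_lattice d c"
    let ?j = "the_inv_into {..<d} (\<lambda>i. c i \<cdot>\<^sub>v unit_vec d i)"
    let ?a = "\<lambda>x. v $ (?j x) / c (?j x)"
    have j: "?j (c i \<cdot>\<^sub>v unit_vec d i) = i" if "i < d" for i
      using the_inv_into_f_f[OF inj_on_gens] that by auto
    have "lincomb ?a gens = v"
      by (rule lincomb_gens) (use v in \<open>simp_all add: diag_lattice_def j\<close>)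
    moreover have "?a \<in> gens \<rightarrow> range fps_to_fls"
      using v by (auto simp: diag_lattice_def j)
    ultimately show "v \<in> O_span d gens"
      unfolding O_span_def om.span_def O by (intro CollectI exI[of _ ?a] exI[of _ gens]) simp
  qed
qed

lemma is_lattice_diag_lattice: "is_lattice d (diag_lattice d c)"
proof -
  interpret vec_space "TYPE('a fls)" d .
  have sub: "diag_lattice d c \<subseteq> carrier_vec d" by (auto simp: diag_lattice_def)
  have gens: "gens \<subseteq> diag_lattice d c"
  proof (intro subsetI)
    fix x assume "x \<in> gens"
    then obtain j where "j < d" "x = c j \<cdot>\<^sub>v unit_vec d j" by auto
    thus "x \<in> diag_lattice d c" using c unfolding diag_lattice_def range_fps_to_fls_iff
      by auto
  qed
  have "v \<in> span (diag_lattice d c)" if v: "v \<in> carrier_vec d" for v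
  proof -
    let ?j = "the_inv_into {..<d} (\<lambda>i. c i \<cdot>\<^sub>v unit_vec d i)"
    have "lincomb (\<lambda>x. v $ (?j x) / c (?j x)) gens = v"
      by (rule lincomb_gens[OF v]) (simp add: the_inv_into_f_f[OF inj_on_gens])
    thus ?thesis unfolding span_def using gens
      by (intro CollectI exI[of _ "\<lambda>x. v $ (?j x) / c (?j x)"] exI[of _ gens]) simp
  qed
  hence "F_span d (diag_lattice d c) = carrier_vec d"
    unfolding F_span_def using span_is_subset2[OF sub] by auto
  moreover have "gens \<subseteq> carrier_vec d" by auto
  ultimately show ?thesis
    unfolding is_lattice_def using O_span_gens by (metis finite_imageI finite_lessThan)
qed

end

subsection \<open>Matrices preserving a diagonal lattice up to scaling\<close>

lemma comm_ring_hom_fps_to_fls: "comm_ring_hom (fps_to_fls :: 'a::field fps \<Rightarrow> 'a fls)"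
  by unfold_locales (auto simp: fls_times_fps_to_fls)

lemma comm_ring_hom_poly_to_F: "comm_ring_hom (poly_to_F :: 'a::field poly \<Rightarrow> 'a fls)"
proof -
  interpret c: comm_ring_hom "fls_const :: 'a \<Rightarrow> 'a fls"
    by unfold_locales (auto simp: fls_plus_const fls_const_mult_const)
  interpret m: map_poly_comm_ring_hom "fls_const :: 'a \<Rightarrow> 'a fls" ..
  show ?thesis
    by unfold_locales (auto simp: poly_to_F_def m.hom_add m.hom_mult)
qed

text \<open>Since t is the inverse of the series variable, the coefficient of t^n sits at exponent
  -n.\<close>

lemma fls_nth_poly_to_F:
  "fls_nth (poly_to_F p) n = (if n \<le> 0 then coeff p (nat (- n)) else 0)"
proof (induction p arbitrary: n)
  case (pCons a p)
  have "poly_to_F (pCons a p) = fls_const a + fls_X_inv * poly_to_F p"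
    unfolding poly_to_F_def by (cases "pCons a p = 0") (simp_all add: map_poly_pCons)
  thus ?case
    using pCons.IH[of "n + 1"] by (auto simp: fls_X_inv_times_conv_shift coeff_pCons nat_diff_distrib split: nat.splits)
qed (simp add: poly_to_F_def)

lemma poly_to_F_eq_0_iff [simp]: "poly_to_F p = 0 \<longleftrightarrow> p = 0"
proof
  assume "poly_to_F p = 0"
  hence "coeff p n = 0" for n using fls_nth_poly_to_F[of p "- int n"] by simp
  thus "p = 0" by (simp add: poly_eqI)
qed (simp add: poly_to_F_def)

text \<open>The valuation at infinity is minus the degree; for p = 0 both are 0 by
  convention.\<close>

lemma fls_subdegree_poly_to_F: "fls_subdegree (poly_to_F p) = - int (degree p)"
proof (cases "p = 0")
  case False
  show ?thesis
    by (rule fls_subdegree_eqI) (use False in \<open>auto simp: fls_nth_poly_to_F intro!: coeff_eq_0\<close>)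
qed (simp add: poly_to_F_def)

section \<open>The groups GL_d over a commutative ring\<close>

text \<open>Multiplicativity of the determinant gives one direction. For the other, the adjugate
  times the inverse of the determinant is an inverse over any commutative ring.\<close>

lemma carrier_GL: "carrier (GL d) = {A \<in> carrier_mat d d. det A dvd (1::'r::comm_ring_1)}"
proof (intro equalityI subsetI)
  fix A :: "'r mat" assume "A \<in> carrier (GL d)"
  then obtain B where A: "A \<in> carrier_mat d d" and B: "B \<in> carrier_mat d d" and "A * B = 1\<^sub>m d"
    by (auto simp: GL_def units_of_def Units_def ring_mat_simps)
  hence "det A * det B = 1" by (metis det_mult det_one)
  with A show "A \<in> {A \<in> carrier_mat d d. det A dvd 1}" by (metis (mono_tags, lifting) dvd_triv_left mem_Collect_eq)
next
  fix A :: "'r mat" assume "A \<in> {A \<in> carrier_mat d d. det A dvd 1}"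
  then obtain k where A: "A \<in> carrier_mat d d" and k: "1 = det A * k" by (auto elim: dvdE)
  let ?B = "k \<cdot>\<^sub>m adj_mat A"
  have "A * ?B = 1\<^sub>m d" "?B * A = 1\<^sub>m d"
    using adj_mat[OF A] A k by (auto simp: mult_smult_distrib mult_smult_assoc_mat[of _ d d _ d] mult.commute)
  moreover have "?B \<in> carrier_mat d d" using adj_mat(1)[OF A] by simp
  ultimately show "A \<in> carrier (GL d)"
    using A unfolding GL_def units_of_def Units_def by (auto simp: ring_mat_simps)
qed

lemma mult_GL [simp]: "A \<otimes>\<^bsub>GL d\<^esub> B = A * B"
  by (simp add: GL_def units_of_def ring_mat_simps)

lemma one_GL [simp]: "\<one>\<^bsub>GL n\<^esub> = 1\<^sub>m n"
  by (simp add: GL_def units_of_def ring_mat_simps)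

lemma group_GL: "group (GL d :: 'r::comm_ring_1 mat monoid)"
proof -
  interpret semiring "ring_mat TYPE('r) d ()" by (rule semiring_mat)
  show ?thesis unfolding GL_def by (rule units_group)
qed

text \<open>An element of \<open>GL_d(F)\<close> whose determinant has valuation \<open>0\<close> can move a diagonal lattice to a multiple of
  itself only by fixing it, and it does so exactly when its conjugate by the diagonal matrix is
  integral.\<close>

context
  fixes d :: nat and c :: "nat \<Rightarrow> 'a::field fls" and g :: "'a fls mat"
  assumes d: "0 < d" and c: "\<And>i. i < d \<Longrightarrow> c i \<noteq> 0"
    and g: "g \<in> carrier_mat d d" and det_g: "det g \<noteq> 0" "fls_subdegree (det g) = 0"
begin

text \<open>This is D^(-1) g D for the diagonal matrix D with entries c_i, that is, the matrix of
  \<open>g\<close> in the basis c_i e_i.\<close>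

definition conj_diag :: "'a fls mat" where
  "conj_diag = mat d d (\<lambda>(i, j). g $$ (i, j) * c j / c i)"

lemma conj_diag_carrier: "conj_diag \<in> carrier_mat d d"
  by (simp add: conj_diag_def)

lemma det_conj_diag: "det conj_diag = det g"
proof -
  let ?D = "mat d d (\<lambda>(i, j). if i = j then c i else 0)"
  let ?E = "mat d d (\<lambda>(i, j). if i = j then 1 / c i else 0)"
  have eq: "?D * conj_diag = g * ?D"
  proof (rule eq_matI)
    fix i j assume "i < dim_row (g * ?D)" "j < dim_col (g * ?D)"
    hence ij: "i < d" "j < d" using g by auto
    have "(?D * conj_diag) $$ (i, j) = (\<Sum>k<d. (if i = k then c i else 0) * (g $$ (k, j) * c j / c k))"
      using ij by (auto simp: conj_diag_def scalar_prod_def lessThan_atLeast0 intro!: sum.cong)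
    also have "\<dots> = (\<Sum>k<d. if i = k then c i * (g $$ (i, j) * c j / c i) else 0)"
      by (rule sum.cong) auto
    also have "\<dots> = g $$ (i, j) * c j" using ij c[of i] by simp
    also have "\<dots> = (\<Sum>k<d. if k = j then g $$ (i, j) * c j else 0)" using ij by simp
    also have "\<dots> = (\<Sum>k<d. g $$ (i, k) * (if k = j then c k else 0))"
      by (rule sum.cong) auto
    also have "\<dots> = (g * ?D) $$ (i, j)"
      using ij g by (auto simp: scalar_prod_def lessThan_atLeast0 intro!: sum.cong)
    finally show "(?D * conj_diag) $$ (i, j) = (g * ?D) $$ (i, j)" .
  qed (use g in \<open>auto simp: conj_diag_def\<close>)
  have "det ?D = prod_list (diag_mat ?D)"
    by (rule det_upper_triangular[of _ d]) auto
  also have "\<dots> \<noteq> 0" using c by (auto simp: diag_mat_def prod_list_zero_iff)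
  finally have D: "det ?D \<noteq> 0" .
  have "det ?D * det conj_diag = det g * det ?D"
    using arg_cong[OF eq, of det] g
    by (simp add: det_mult[of _ d] conj_diag_carrier)
  thus ?thesis using D by simp
qed

text \<open>As a matrix over power series, an integral matrix has its determinant and adjugate
  inside \<O>.\<close>

lemma integral_mat_lift:
  assumes "M \<in> carrier_mat d d" "\<And>i j. i < d \<Longrightarrow> j < d \<Longrightarrow> M $$ (i, j) \<in> range fps_to_fls"
  obtains N where "N \<in> carrier_mat d d" "M = map_mat (fps_to_fls :: 'a fps \<Rightarrow> _) N"
proof -
  have "M = map_mat fps_to_fls (map_mat fls_regpart M)"
  proof (rule eq_matI)
    fix i j assume "i < dim_row (map_mat fps_to_fls (map_mat fls_regpart M))"
      "j < dim_col (map_mat fps_to_fls (map_mat fls_regpart M))"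
    hence "i < d" "j < d" using assms(1) by auto
    moreover from this obtain f where "M $$ (i, j) = fps_to_fls f" using assms(2) by blast
    ultimately show "M $$ (i, j) = map_mat fps_to_fls (map_mat fls_regpart M) $$ (i, j)"
      using assms(1) by simp
  qed auto
  thus ?thesis using that[of "map_mat fls_regpart M"] assms(1) by simp
qed

lemma det_integral:
  assumes "M \<in> carrier_mat d d" "\<And>i j. i < d \<Longrightarrow> j < d \<Longrightarrow> M $$ (i, j) \<in> range fps_to_fls"
  shows "det M \<in> range (fps_to_fls :: 'a fps \<Rightarrow> _)"
proof -
  interpret comm_ring_hom "fps_to_fls :: 'a fps \<Rightarrow> 'a fls" by (rule comm_ring_hom_fps_to_fls)
  from integral_mat_lift[OF assms] obtain N where "M = map_mat fps_to_fls N" by blast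
  thus ?thesis by (simp add: hom_det)
qed

lemma mult_mat_vec_div:
  assumes u: "u \<in> carrier_vec d" and i: "i < d"
  shows "(g *\<^sub>v u) $ i / c i = (\<Sum>j<d. conj_diag $$ (i, j) * (u $ j / c j))"
proof -
  have "(g *\<^sub>v u) $ i / c i = (\<Sum>j<d. g $$ (i, j) * u $ j / c i)"
    using g u i by (simp add: scalar_prod_def lessThan_atLeast0 sum_divide_distrib)
  also have "\<dots> = (\<Sum>j<d. conj_diag $$ (i, j) * (u $ j / c j))"
    using c i by (intro sum.cong) (auto simp: conj_diag_def field_simps)
  finally show ?thesis .
qed

text \<open>Integrality gives the inclusion of g L in L. For the other inclusion, det g is a unit of
  \<O>, so the adjugate provides an integral inverse of \<open>conj_diag\<close>.\<close>

lemma integral_imp_fixes: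
  assumes int: "\<And>i j. i < d \<Longrightarrow> j < d \<Longrightarrow> conj_diag $$ (i, j) \<in> range fps_to_fls"
  shows "(\<lambda>v. g *\<^sub>v v) ` diag_lattice d c = diag_lattice d c"
proof (intro equalityI subsetI)
  fix v assume "v \<in> (\<lambda>v. g *\<^sub>v v) ` diag_lattice d c"
  then obtain u where u: "u \<in> diag_lattice d c" "v = g *\<^sub>v u" by blast
  have uc: "u \<in> carrier_vec d" using u by (simp add: diag_lattice_def)
  show "v \<in> diag_lattice d c"
    unfolding diag_lattice_def u(2)
  proof (intro CollectI conjI allI impI)
    show "g *\<^sub>v u \<in> carrier_vec d" using g uc by (rule mult_mat_vec_carrier)
    show "(g *\<^sub>v u) $ i / c i \<in> range fps_to_fls" if "i < d" for i
      unfolding mult_mat_vec_div[OF uc that] using u(1) int that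
      by (intro range_fps_to_fls_sum range_fps_to_fls_mult) (auto simp: diag_lattice_def)
  qed
next
  fix v assume v: "v \<in> diag_lattice d c"
  interpret h: comm_ring_hom "fps_to_fls :: 'a fps \<Rightarrow> 'a fls" by (rule comm_ring_hom_fps_to_fls)
  obtain N where N: "N \<in> carrier_mat d d" and MN: "conj_diag = map_mat fps_to_fls N"
    using integral_mat_lift[OF conj_diag_carrier int] by blast
  have "fps_to_fls (det N) = det g" using det_conj_diag MN by (simp add: h.hom_det)
  hence "det N \<noteq> 0" "subdegree (det N) = 0"
    using det_g fls_subdegree_fls_to_fps[of "det N"] by auto
  hence "fps_nth (det N) 0 \<noteq> 0" by (metis nth_subdegree_nonzero)
  hence "det N * inverse (det N) = 1" by (simp add: inverse_mult_eq_1')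
  define P where "P = inverse (det N) \<cdot>\<^sub>m adj_mat N"
  have P: "P \<in> carrier_mat d d" using adj_mat(1)[OF N] by (simp add: P_def)
  have "N * P = 1\<^sub>m d"
    using adj_mat[OF N] N \<open>det N * inverse (det N) = 1\<close>
    by (auto simp: P_def mult_smult_distrib mult.commute)
  hence one: "conj_diag * map_mat fps_to_fls P = 1\<^sub>m d"
    unfolding MN using h.mat_hom_mult[OF N P] h.mat_hom_one by metis
  \<comment> \<open>\<open>w\<close> holds the coordinates of \<open>v\<close> in the basis c_i e_i,
    \<open>x\<close> is its integral preimage under \<open>conj_diag\<close>, and \<open>u\<close>
    below is \<open>x\<close> written back in standard coordinates.\<close>
  define w where "w = vec d (\<lambda>i. v $ i / c i)"
  define x where "x = map_mat fps_to_fls P *\<^sub>v w"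
  have w: "w \<in> carrier_vec d" and x: "x \<in> carrier_vec d" using P by (auto simp: w_def x_def)
  have "conj_diag *\<^sub>v x = (conj_diag * map_mat fps_to_fls P) *\<^sub>v w"
    unfolding x_def by (rule assoc_mult_mat_vec[symmetric, OF conj_diag_carrier _ w]) (use P in auto)
  hence Mx: "conj_diag *\<^sub>v x = w" using one w by simp
  define u where "u = vec d (\<lambda>i. c i * x $ i)"
  have uc: "u \<in> carrier_vec d" by (simp add: u_def)
  have "x $ i \<in> range fps_to_fls" if "i < d" for i
  proof -
    have "x $ i = (\<Sum>j<d. fps_to_fls (P $$ (i, j)) * (v $ j / c j))"
      using that P by (auto simp: x_def w_def scalar_prod_def lessThan_atLeast0)
    also have "\<dots> \<in> range fps_to_fls"
      using v by (intro range_fps_to_fls_sum range_fps_to_fls_mult) (auto simp: diag_lattice_def)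
    finally show ?thesis .
  qed
  hence u: "u \<in> diag_lattice d c" using c by (auto simp: diag_lattice_def u_def)
  have "g *\<^sub>v u = v"
  proof (rule eq_vecI)
    fix i assume "i < dim_vec v"
    hence i: "i < d" using v by (auto simp: diag_lattice_def)
    have "(g *\<^sub>v u) $ i / c i = (\<Sum>j<d. conj_diag $$ (i, j) * x $ j)"
      unfolding mult_mat_vec_div[OF uc i] using c by (intro sum.cong) (auto simp: u_def)
    also have "\<dots> = (conj_diag *\<^sub>v x) $ i"
      using i x conj_diag_carrier by (simp add: scalar_prod_def lessThan_atLeast0)
    also have "\<dots> = v $ i / c i" using i by (simp add: Mx w_def)
    finally show "(g *\<^sub>v u) $ i = v $ i" using c[OF i] by simp
  qed (use v g in \<open>auto simp: diag_lattice_def\<close>)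
  thus "v \<in> (\<lambda>v. g *\<^sub>v v) ` diag_lattice d c" using u by blast
qed

text \<open>Images of the generators show that the entries of \<open>conj_diag\<close> lie in a
  \<O>, so it remains to see that \<open>a\<close> is integral. Preimages of the vectors a c_j e_j
  give this through determinants, because det g has valuation 0.\<close>

lemma scales_imp_integral:
  assumes a: "a \<noteq> 0" and eq: "(\<lambda>v. g *\<^sub>v v) ` diag_lattice d c = (\<lambda>v. a \<cdot>\<^sub>v v) ` diag_lattice d c"
    and ij: "i < d" "j < d"
  shows "conj_diag $$ (i, j) \<in> range fps_to_fls"
proof -
  let ?e = "\<lambda>j. c j \<cdot>\<^sub>v unit_vec d j"
  have e: "?e j \<in> diag_lattice d c" if "j < d" for j
    using that c by (auto simp: diag_lattice_def range_fps_to_fls_iff)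
  have ge: "(g *\<^sub>v ?e j) $ i / c i = conj_diag $$ (i, j)" if ij: "i < d" "j < d" for i j
  proof -
    have "(g *\<^sub>v ?e j) $ i / c i = (\<Sum>k<d. conj_diag $$ (i, k) * (?e j $ k / c k))"
      by (rule mult_mat_vec_div) (use ij in auto)
    also have "\<dots> = (\<Sum>k<d. if k = j then conj_diag $$ (i, j) else 0)"
      using c ij by (intro sum.cong) auto
    also have "\<dots> = conj_diag $$ (i, j)" using ij by simp
    finally show ?thesis .
  qed
  have "\<exists>u\<in>diag_lattice d c. g *\<^sub>v u = a \<cdot>\<^sub>v ?e j" if "j < d" for j
    using e[OF that] eq by (metis (no_types, lifting) imageE imageI)
  then obtain u where u: "\<And>j. j < d \<Longrightarrow> u j \<in> diag_lattice d c"
    and gu: "\<And>j. j < d \<Longrightarrow> g *\<^sub>v u j = a \<cdot>\<^sub>v ?e j" by metis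
  \<comment> \<open>\<open>U\<close> is integral and \<open>conj_diag * U = a\<close>, so \<open>a^d\<close> and hence \<open>a\<close> is integral.\<close>
  define U where "U = mat d d (\<lambda>(i, j). u j $ i / c i)"
  have U: "U \<in> carrier_mat d d" by (simp add: U_def)
  have "conj_diag * U = a \<cdot>\<^sub>m 1\<^sub>m d"
  proof (rule eq_matI)
    fix i j assume "i < dim_row (a \<cdot>\<^sub>m 1\<^sub>m d :: 'a fls mat)" "j < dim_col (a \<cdot>\<^sub>m 1\<^sub>m d :: 'a fls mat)"
    hence ij: "i < d" "j < d" by auto
    have "(conj_diag * U) $$ (i, j) = (\<Sum>k<d. conj_diag $$ (i, k) * (u j $ k / c k))"
      using ij conj_diag_carrier by (auto simp: U_def scalar_prod_def lessThan_atLeast0 intro!: sum.cong)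
    also have "\<dots> = (g *\<^sub>v u j) $ i / c i"
      using u[OF ij(2)] by (intro mult_mat_vec_div[symmetric]) (auto simp: diag_lattice_def ij)
    also have "\<dots> = (a \<cdot>\<^sub>m 1\<^sub>m d) $$ (i, j)" using ij c by (auto simp: gu)
    finally show "(conj_diag * U) $$ (i, j) = (a \<cdot>\<^sub>m 1\<^sub>m d) $$ (i, j)" .
  qed (use conj_diag_carrier U in auto)
  hence "det g * det U = a ^ d"
    using det_mult[OF conj_diag_carrier U] by (simp add: det_conj_diag det_smult)
  moreover have "det U \<in> range fps_to_fls"
    by (rule det_integral[OF U]) (use u in \<open>auto simp: U_def diag_lattice_def\<close>)
  ultimately have "0 \<le> fls_subdegree (a ^ d)"
    using det_g by (metis range_fps_to_fls_iff fls_mult_subdegree_ge_0 order_refl)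
  hence "a \<in> range fps_to_fls"
    using d a by (simp add: range_fps_to_fls_iff fls_subdegree_pow zero_le_mult_iff)
  moreover have "conj_diag $$ (i, j) / a \<in> range fps_to_fls"
  proof -
    obtain v where v: "v \<in> diag_lattice d c" "g *\<^sub>v ?e j = a \<cdot>\<^sub>v v"
      using e[OF ij(2)] eq by (metis (no_types, lifting) imageE imageI)
    have "conj_diag $$ (i, j) / a = v $ i / c i"
      using ge[OF ij] v a ij by (auto simp: diag_lattice_def field_simps)
    thus ?thesis using v ij by (auto simp: diag_lattice_def)
  qed
  ultimately show ?thesis using range_fps_to_fls_mult[of a "conj_diag $$ (i, j) / a"] a by simp
qed

end

subsection \<open>The stabilizer as a quotient by the scalars\<close>

text \<open>An explicit form of the stabilizer of the lattice itself rather than of its class. The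
  zero polynomial has degree 0, so zero entries are allowed separately; when the bound is negative,
  nothing else is possible.\<close>

definition bounded_GL :: "nat \<Rightarrow> int list \<Rightarrow> 'a::field poly mat set" where
  "bounded_GL d ns = {g \<in> carrier_mat d d. det g dvd 1 \<and>
     (\<forall>i<d. \<forall>j<d. g $$ (i, j) = 0 \<or> int (degree (g $$ (i, j))) \<le> ns ! i - ns ! j)}"

lemma standard_lattice_eq:
  "standard_lattice d ns = diag_lattice d (\<lambda>i. fls_X_inv powi (ns ! i))"
  unfolding standard_lattice_def by (rule O_span_gens) simp

section \<open>Scaling classes and the action of PGL_d\<close>

lemma smult_diag_lattice:
  assumes "a \<noteq> (0 :: 'a::field fls)"
  shows "(\<lambda>v. a \<cdot>\<^sub>v v) ` diag_lattice d c = diag_lattice d (\<lambda>i. a * c i)"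
proof (intro equalityI subsetI)
  fix v assume v: "v \<in> diag_lattice d (\<lambda>i. a * c i)"
  have "v = a \<cdot>\<^sub>v ((1 / a) \<cdot>\<^sub>v v)" using assms by (simp add: smult_smult_assoc)
  moreover have "(1 / a) \<cdot>\<^sub>v v \<in> diag_lattice d c"
    using v by (auto simp: diag_lattice_def)
  ultimately show "v \<in> (\<lambda>v. a \<cdot>\<^sub>v v) ` diag_lattice d c" by blast
qed (use assms in \<open>auto simp: diag_lattice_def\<close>)

text \<open>A nonzero multiple of a diagonal lattice is again diagonal and hence a lattice, so every
  multiple does occur in the class.\<close>

lemma lattice_class_diag_lattice:
  assumes "\<And>i. i < d \<Longrightarrow> c i \<noteq> (0 :: 'a::field fls)"
  shows "lattice_class d (diag_lattice d c) = (\<lambda>a. (\<lambda>v. a \<cdot>\<^sub>v v) ` diag_lattice d c) ` (- {0})"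
proof -
  have "is_lattice d ((\<lambda>v. a \<cdot>\<^sub>v v) ` diag_lattice d c)" if "a \<noteq> 0" for a
    unfolding smult_diag_lattice[OF that] using that assms by (intro is_lattice_diag_lattice) auto
  thus ?thesis
    using is_lattice_diag_lattice[of d c] assms by (auto simp: lattice_class_def lattice_equiv_def)
qed

text \<open>The units of F_q[t] become nonzero scalars of F, so multiplying by all nonzero scalars
  of F absorbs the choice of representative in the coset.\<close>

lemma PGL_poly_to_F_coset:
  assumes g: "g \<in> carrier_mat d d"
  shows "PGL_poly_to_F d (scalars d #>\<^bsub>GL d\<^esub> g) = (\<lambda>a. a \<cdot>\<^sub>m map_mat poly_to_F g) ` (- {0 :: 'a::field fls})"
proof -
  interpret h: comm_ring_hom "poly_to_F :: 'a poly \<Rightarrow> 'a fls" by (rule comm_ring_hom_poly_to_F)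
  have coset: "scalars d #>\<^bsub>GL d\<^esub> g = {u \<cdot>\<^sub>m g | u. u dvd 1}"
    using g by (auto simp: r_coset_def scalars_def mult_smult_assoc_mat[of _ d d _ d])
  have scalars_F: "scalars d = {a \<cdot>\<^sub>m 1\<^sub>m d | a :: 'a fls. a \<noteq> 0}"
    by (simp add: scalars_def dvd_field_iff)
  have mult: "(a \<cdot>\<^sub>m 1\<^sub>m d) * map_mat poly_to_F (u \<cdot>\<^sub>m g) = (a * poly_to_F u) \<cdot>\<^sub>m map_mat poly_to_F g"
    for a u
    using g by (auto simp: h.hom_mult mult_smult_assoc_mat[of _ d d _ d] intro!: eq_matI)
  have unit: "poly_to_F u \<noteq> 0" if "u dvd 1" for u :: "'a poly" using that by auto
  have "PGL_poly_to_F d (scalars d #>\<^bsub>GL d\<^esub> g) =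
      {(a * poly_to_F u) \<cdot>\<^sub>m map_mat poly_to_F g | a u. a \<noteq> 0 \<and> u dvd 1}"
    unfolding PGL_poly_to_F_def coset set_mult_def scalars_F mult_GL
  proof (intro equalityI subsetI)
    fix x assume "x \<in> (\<Union>s\<in>{a \<cdot>\<^sub>m 1\<^sub>m d | a :: 'a fls. a \<noteq> 0}.
      \<Union>h\<in>map_mat poly_to_F ` {u \<cdot>\<^sub>m g | u. u dvd 1}. {s * h})"
    then obtain a u where "a \<noteq> 0" "u dvd 1" "x = (a \<cdot>\<^sub>m 1\<^sub>m d) * map_mat poly_to_F (u \<cdot>\<^sub>m g)"
      by blast
    thus "x \<in> {(a * poly_to_F u) \<cdot>\<^sub>m map_mat poly_to_F g | a u. a \<noteq> 0 \<and> u dvd 1}"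
      unfolding mult by blast
  next
    fix x assume "x \<in> {(a * poly_to_F u) \<cdot>\<^sub>m map_mat poly_to_F g | a u. a \<noteq> 0 \<and> u dvd 1}"
    then obtain a u where "a \<noteq> 0" "u dvd 1" "x = (a \<cdot>\<^sub>m 1\<^sub>m d) * map_mat poly_to_F (u \<cdot>\<^sub>m g)"
      unfolding mult by blast
    thus "x \<in> (\<Union>s\<in>{a \<cdot>\<^sub>m 1\<^sub>m d | a :: 'a fls. a \<noteq> 0}.
      \<Union>h\<in>map_mat poly_to_F ` {u \<cdot>\<^sub>m g | u. u dvd 1}. {s * h})"
      by blast
  qed
  also have "\<dots> = (\<lambda>a. a \<cdot>\<^sub>m map_mat poly_to_F g) ` (- {0})"
  proof (intro equalityI subsetI)
    fix x assume "x \<in> (\<lambda>a. a \<cdot>\<^sub>m map_mat poly_to_F g) ` (- {0})"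
    then obtain a where "a \<noteq> 0" "x = (a * poly_to_F 1) \<cdot>\<^sub>m map_mat poly_to_F g" by (auto simp: h.hom_one)
    thus "x \<in> {(a * poly_to_F u) \<cdot>\<^sub>m map_mat poly_to_F g | a u. a \<noteq> 0 \<and> u dvd 1}"
      using one_dvd by blast
  next
    fix x assume "x \<in> {(a * poly_to_F u) \<cdot>\<^sub>m map_mat poly_to_F g | a u. a \<noteq> 0 \<and> u dvd 1}"
    then obtain a u where "a \<noteq> 0" "u dvd 1" "x = (a * poly_to_F u) \<cdot>\<^sub>m map_mat poly_to_F g" by blast
    thus "x \<in> (\<lambda>a. a \<cdot>\<^sub>m map_mat poly_to_F g) ` (- {0})"
      using unit by (intro image_eqI[of _ _ "a * poly_to_F u"]) auto
  qed
  finally show ?thesis .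
qed

text \<open>The image of V consists of all nonzero multiples of g L, and V of all nonzero multiples
  of L; two such families agree once they share a member.\<close>

lemma coset_fixes_class_iff:
  fixes g :: "'a::field poly mat"
  assumes g: "g \<in> carrier_mat d d" and c: "\<And>i. i < d \<Longrightarrow> c i \<noteq> 0"
  defines "L \<equiv> diag_lattice d c" and "V \<equiv> lattice_class d (diag_lattice d c)"
  shows "PGL_act (PGL_poly_to_F d (scalars d #>\<^bsub>GL d\<^esub> g)) V = V \<longleftrightarrow>
    (\<exists>a. a \<noteq> 0 \<and> (\<lambda>v. map_mat poly_to_F g *\<^sub>v v) ` L = (\<lambda>v. a \<cdot>\<^sub>v v) ` L)"
proof -
  let ?G = "map_mat poly_to_F g"
  have V: "V = (\<lambda>a. (\<lambda>v. a \<cdot>\<^sub>v v) ` L) ` (- {0})"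
    unfolding V_def L_def by (rule lattice_class_diag_lattice[OF c])
  have Lc: "L \<subseteq> carrier_vec d" by (auto simp: L_def diag_lattice_def)
  have scale: "(\<lambda>v. (a \<cdot>\<^sub>m ?G) *\<^sub>v v) ` (\<lambda>v. b \<cdot>\<^sub>v v) ` L = (\<lambda>v. (a * b) \<cdot>\<^sub>v v) ` (\<lambda>v. ?G *\<^sub>v v) ` L" for a b
    unfolding image_image
  proof (rule image_cong)
    fix v assume "v \<in> L"
    hence "v \<in> carrier_vec d" using Lc by blast
    thus "(a \<cdot>\<^sub>m ?G) *\<^sub>v (b \<cdot>\<^sub>v v) = (a * b) \<cdot>\<^sub>v (?G *\<^sub>v v)"
      using g by (intro eq_vecI) (auto simp: scalar_prod_def sum_distrib_left mult_ac intro!: sum.cong)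
  qed simp
  have "PGL_act (PGL_poly_to_F d (scalars d #>\<^bsub>GL d\<^esub> g)) V =
      {(\<lambda>v. (a * b) \<cdot>\<^sub>v v) ` (\<lambda>v. ?G *\<^sub>v v) ` L | a b. a \<noteq> 0 \<and> b \<noteq> 0}"
    unfolding PGL_act_def PGL_poly_to_F_coset[OF g] V using scale by blast
  also have "\<dots> = (\<lambda>a. (\<lambda>v. a \<cdot>\<^sub>v v) ` (\<lambda>v. ?G *\<^sub>v v) ` L) ` (- {0})"
  proof (intro equalityI subsetI)
    fix x assume "x \<in> (\<lambda>a. (\<lambda>v. a \<cdot>\<^sub>v v) ` (\<lambda>v. ?G *\<^sub>v v) ` L) ` (- {0})"
    then obtain a where "a \<noteq> 0" "x = (\<lambda>v. (a * 1) \<cdot>\<^sub>v v) ` (\<lambda>v. ?G *\<^sub>v v) ` L" by auto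
    thus "x \<in> {(\<lambda>v. (a * b) \<cdot>\<^sub>v v) ` (\<lambda>v. ?G *\<^sub>v v) ` L | a b. a \<noteq> 0 \<and> b \<noteq> 0}"
      using one_neq_zero by blast
  next
    fix x assume "x \<in> {(\<lambda>v. (a * b) \<cdot>\<^sub>v v) ` (\<lambda>v. ?G *\<^sub>v v) ` L | a b. a \<noteq> 0 \<and> b \<noteq> 0}"
    then obtain a b where "a \<noteq> 0" "b \<noteq> 0" "x = (\<lambda>v. (a * b) \<cdot>\<^sub>v v) ` (\<lambda>v. ?G *\<^sub>v v) ` L" by blast
    thus "x \<in> (\<lambda>a. (\<lambda>v. a \<cdot>\<^sub>v v) ` (\<lambda>v. ?G *\<^sub>v v) ` L) ` (- {0})"
      by (intro image_eqI[of _ _ "a * b"]) auto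
  qed
  finally have act: "PGL_act (PGL_poly_to_F d (scalars d #>\<^bsub>GL d\<^esub> g)) V =
      (\<lambda>a. (\<lambda>v. a \<cdot>\<^sub>v v) ` (\<lambda>v. ?G *\<^sub>v v) ` L) ` (- {0})" .
  show ?thesis
  proof
    assume eq: "PGL_act (PGL_poly_to_F d (scalars d #>\<^bsub>GL d\<^esub> g)) V = V"
    have "(\<lambda>v. ?G *\<^sub>v v) ` L = (\<lambda>v. 1 \<cdot>\<^sub>v v) ` (\<lambda>v. ?G *\<^sub>v v) ` L" by simp
    hence "(\<lambda>v. ?G *\<^sub>v v) ` L \<in> V" using act eq by (metis (no_types, lifting) ComplI image_eqI one_neq_zero singletonD)
    thus "\<exists>a. a \<noteq> 0 \<and> (\<lambda>v. ?G *\<^sub>v v) ` L = (\<lambda>v. a \<cdot>\<^sub>v v) ` L" unfolding V by blast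
  next
    assume "\<exists>a. a \<noteq> 0 \<and> (\<lambda>v. ?G *\<^sub>v v) ` L = (\<lambda>v. a \<cdot>\<^sub>v v) ` L"
    then obtain a where a: "a \<noteq> 0" "(\<lambda>v. ?G *\<^sub>v v) ` L = (\<lambda>v. a \<cdot>\<^sub>v v) ` L" by blast
    have "(\<lambda>b. (\<lambda>v. b \<cdot>\<^sub>v v) ` (\<lambda>v. ?G *\<^sub>v v) ` L) ` (- {0}) = (\<lambda>b. (\<lambda>v. (b * a) \<cdot>\<^sub>v v) ` L) ` (- {0})"
      unfolding a(2) image_image by (simp add: smult_smult_assoc)
    also have "\<dots> = (\<lambda>b. (\<lambda>v. b \<cdot>\<^sub>v v) ` L) ` (\<lambda>b. b * a) ` (- {0})" by (simp add: image_image)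
    also have "(\<lambda>b. b * a) ` (- {0}) = - {0}"
    proof (intro equalityI subsetI)
      fix b assume "b \<in> - {0 :: 'a fls}"
      thus "b \<in> (\<lambda>b. b * a) ` (- {0})" using a(1) by (intro image_eqI[of _ _ "b / a"]) auto
    qed (use a(1) in auto)
    finally show "PGL_act (PGL_poly_to_F d (scalars d #>\<^bsub>GL d\<^esub> g)) V = V"
      using act V by simp
  qed
qed

section \<open>The lattice stabilizer modulo scalars\<close>

lemma is_unit_poly_iff_const: "(p :: 'a::field poly) dvd 1 \<longleftrightarrow> (\<exists>c. c \<noteq> 0 \<and> p = [:c:])"
  unfolding is_unit_poly_iff by (simp add: dvd_field_iff) blast

lemma scalars_poly: "scalars d = (\<lambda>c. [:c:] \<cdot>\<^sub>m 1\<^sub>m d) ` (- {0 :: 'a::field})"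
  unfolding scalars_def is_unit_poly_iff_const by blast

context
  fixes d :: nat and ns :: "int list"
  assumes d: "0 < d"
begin

text \<open>A nonzero entry (i, j), conjugated by the diagonal matrix of the t^(n_i), has valuation
  n_i - n_j - deg g_ij, which turns integrality into the degree bound. The implications form a
  cycle: the bound, g L = L, g L = a L for some a, and the bound again. The first form serves the
  group axioms, the second the vertex stabilizer.\<close>

lemma bounded_GL_iff:
  fixes g :: "'a::field poly mat"
  assumes g: "g \<in> carrier (GL d)"
  defines "L \<equiv> standard_lattice d ns"
  shows "g \<in> bounded_GL d ns \<longleftrightarrow> (\<lambda>v. map_mat poly_to_F g *\<^sub>v v) ` L = L"
    and "g \<in> bounded_GL d ns \<longleftrightarrow>
      (\<exists>a. a \<noteq> 0 \<and> (\<lambda>v. map_mat poly_to_F g *\<^sub>v v) ` L = (\<lambda>v. a \<cdot>\<^sub>v v) ` L)"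
proof -
  interpret h: comm_ring_hom "poly_to_F :: 'a poly \<Rightarrow> 'a fls" by (rule comm_ring_hom_poly_to_F)
  let ?c = "\<lambda>i. fls_X_inv powi (ns ! i) :: 'a fls" and ?G = "map_mat poly_to_F g"
  have gc: "g \<in> carrier_mat d d" "det g dvd 1" using g by (auto simp: carrier_GL)
  have c: "?c i \<noteq> 0" for i by simp
  have det: "det ?G \<noteq> 0" "fls_subdegree (det ?G) = 0"
    using gc(2) by (auto simp: h.hom_det is_unit_poly_iff_const fls_subdegree_poly_to_F)
  have G: "?G \<in> carrier_mat d d" using gc by simp
  have sd: "fls_subdegree (poly_to_F p * ?c j / ?c i) = ns ! i - ns ! j - int (degree p)" if "p \<noteq> 0" for p i j
    using that by (simp add: fls_divide_subdegree fls_subdegree_X_inv_powi fls_subdegree_poly_to_F)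
  have "g \<in> bounded_GL d ns \<longleftrightarrow> (\<forall>i<d. \<forall>j<d. conj_diag d ?c ?G $$ (i, j) \<in> range fps_to_fls)"
  proof -
    have "(g $$ (i, j) = 0 \<or> int (degree (g $$ (i, j))) \<le> ns ! i - ns ! j) \<longleftrightarrow>
        conj_diag d ?c ?G $$ (i, j) \<in> range fps_to_fls" if "i < d" "j < d" for i j
      using that gc sd[of "g $$ (i, j)" j i]
      by (cases "g $$ (i, j) = 0") (simp_all add: conj_diag_def[OF d c G det] range_fps_to_fls_iff)
    thus ?thesis using gc by (auto simp: bounded_GL_def)
  qed
  moreover have "(\<lambda>v. ?G *\<^sub>v v) ` L = L"
    if "\<forall>i<d. \<forall>j<d. conj_diag d ?c ?G $$ (i, j) \<in> range fps_to_fls"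
    unfolding L_def standard_lattice_eq
    using that by (intro integral_imp_fixes[OF d c G det]) auto
  moreover have "\<forall>i<d. \<forall>j<d. conj_diag d ?c ?G $$ (i, j) \<in> range fps_to_fls"
    if "a \<noteq> 0" "(\<lambda>v. ?G *\<^sub>v v) ` L = (\<lambda>v. a \<cdot>\<^sub>v v) ` L" for a
    using scales_imp_integral[where c = ?c, OF d c G det that(1)] that(2)
    unfolding L_def standard_lattice_eq by blast
  moreover have "(\<lambda>v. 1 \<cdot>\<^sub>v v) ` L = L" by simp
  ultimately show "g \<in> bounded_GL d ns \<longleftrightarrow> (\<lambda>v. ?G *\<^sub>v v) ` L = L"
    and "g \<in> bounded_GL d ns \<longleftrightarrow> (\<exists>a. a \<noteq> 0 \<and> (\<lambda>v. ?G *\<^sub>v v) ` L = (\<lambda>v. a \<cdot>\<^sub>v v) ` L)"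
    by (metis one_neq_zero)+
qed

lemma scalars_subset: "scalars d \<subseteq> (bounded_GL d ns :: 'a::field poly mat set)"
  by (auto simp: scalars_poly bounded_GL_def det_smult degree_power_eq)

lemma scalars_nonempty: "scalars d \<noteq> {}"
  unfolding scalars_def using one_dvd by blast

lemma bounded_GL_subset: "bounded_GL d ns \<subseteq> (carrier (GL d) :: 'a::field poly mat set)"
  by (auto simp: bounded_GL_def carrier_GL)

text \<open>Closure under products and inverses is formal for the stabilizer of a lattice, while the
  degree bounds do not display closure under inverses.\<close>

lemma subgroup_bounded_GL: "subgroup (bounded_GL d ns) (GL d :: 'a::field poly mat monoid)"
proof -
  interpret G: group "GL d :: 'a poly mat monoid" by (rule group_GL)
  interpret h: comm_ring_hom "poly_to_F :: 'a poly \<Rightarrow> 'a fls" by (rule comm_ring_hom_poly_to_F)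
  let ?L = "standard_lattice d ns :: 'a fls vec set"
  let ?act = "\<lambda>g. (\<lambda>v. map_mat poly_to_F g *\<^sub>v v) ` ?L"
  have L: "?L \<subseteq> carrier_vec d" by (auto simp: standard_lattice_eq diag_lattice_def)
  have act_mult: "?act (g * h) = (\<lambda>v. map_mat poly_to_F g *\<^sub>v v) ` ?act h"
    if "g \<in> carrier_mat d d" "h \<in> carrier_mat d d" for g h
    unfolding image_image
  proof (rule image_cong)
    fix v assume "v \<in> ?L"
    hence "v \<in> carrier_vec d" using L by blast
    thus "map_mat poly_to_F (g * h) *\<^sub>v v = map_mat poly_to_F g *\<^sub>v (map_mat poly_to_F h *\<^sub>v v)"
      using that by (simp add: h.mat_hom_mult[OF that] assoc_mult_mat_vec[of _ d d _ d])
  qed simp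
  have carr: "g \<in> carrier_mat d d" if "g \<in> carrier (GL d)" for g :: "'a poly mat"
    using that by (simp add: carrier_GL)
  show ?thesis
  proof (rule G.subgroupI)
    show "bounded_GL d ns \<subseteq> (carrier (GL d) :: 'a poly mat set)" by (rule bounded_GL_subset)
    show "(bounded_GL d ns :: 'a poly mat set) \<noteq> {}" using scalars_subset scalars_nonempty by blast
  next
    fix g h :: "'a poly mat" assume gh: "g \<in> bounded_GL d ns" "h \<in> bounded_GL d ns"
    hence c: "g \<in> carrier (GL d)" "h \<in> carrier (GL d)" using bounded_GL_subset by auto
    hence "g * h \<in> carrier (GL d)" using G.m_closed by fastforce
    moreover have "?act (g * h) = ?L"
      using gh c by (simp add: act_mult carr bounded_GL_iff(1))
    ultimately show "g \<otimes>\<^bsub>GL d\<^esub> h \<in> bounded_GL d ns" by (simp add: bounded_GL_iff(1))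
  next
    fix g :: "'a poly mat" assume g: "g \<in> bounded_GL d ns"
    hence c: "g \<in> carrier (GL d)" using bounded_GL_subset by auto
    let ?i = "inv\<^bsub>GL d\<^esub> g"
    have ic: "?i \<in> carrier (GL d)" using c by simp
    have one: "?i * g = 1\<^sub>m d" using G.l_inv[OF c] by simp
    have "?act ?i = (\<lambda>v. map_mat poly_to_F ?i *\<^sub>v v) ` ?act g"
      using g c by (simp add: bounded_GL_iff(1))
    also have "\<dots> = ?act (1\<^sub>m d)" using act_mult[OF carr[OF ic] carr[OF c]] one by simp
    also have "\<dots> = ?L" using L by (auto simp: h.mat_hom_one image_def subset_iff)
    finally show "?i \<in> bounded_GL d ns" using ic by (simp add: bounded_GL_iff(1))
  qed
qed

lemma subgroup_scalars: "subgroup (scalars d) (GL d :: 'a::field poly mat monoid)"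
proof -
  interpret G: group "GL d :: 'a poly mat monoid" by (rule group_GL)
  have m: "([:a:] \<cdot>\<^sub>m 1\<^sub>m d) * ([:b:] \<cdot>\<^sub>m 1\<^sub>m d) = [:a * b:] \<cdot>\<^sub>m 1\<^sub>m d" for a b :: 'a
    by (rule eq_matI) (auto simp: mult_smult_assoc_mat[of _ d d _ d])
  have sub: "scalars d \<subseteq> (carrier (GL d) :: 'a poly mat set)"
    using scalars_subset bounded_GL_subset by blast
  show ?thesis
  proof (rule G.subgroupI[OF sub])
    show "(scalars d :: 'a poly mat set) \<noteq> {}" by (rule scalars_nonempty)
  next
    fix g h :: "'a poly mat" assume "g \<in> scalars d" "h \<in> scalars d"
    then obtain a b where "a \<noteq> 0" "b \<noteq> 0" "g = [:a:] \<cdot>\<^sub>m 1\<^sub>m d" "h = [:b:] \<cdot>\<^sub>m 1\<^sub>m d"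
      by (auto simp: scalars_poly)
    thus "g \<otimes>\<^bsub>GL d\<^esub> h \<in> scalars d"
      by (auto simp: scalars_poly m intro!: image_eqI[of _ _ "a * b"])
  next
    fix g :: "'a poly mat" assume g: "g \<in> scalars d"
    then obtain a where a: "a \<noteq> 0" "g = [:a:] \<cdot>\<^sub>m 1\<^sub>m d" by (auto simp: scalars_poly)
    have bs: "[:inverse a:] \<cdot>\<^sub>m 1\<^sub>m d \<in> scalars d" using a by (auto simp: scalars_poly)
    have "[:1:] \<cdot>\<^sub>m 1\<^sub>m d = (1\<^sub>m d :: 'a poly mat)" by (rule eq_matI) (auto simp: one_pCons)
    hence "inv\<^bsub>GL d\<^esub> g = [:inverse a:] \<cdot>\<^sub>m 1\<^sub>m d"
      using a bs g sub by (intro G.inv_equality) (auto simp: m)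
    thus "inv\<^bsub>GL d\<^esub> g \<in> scalars d" using bs by simp
  qed
qed

text \<open>Cosets depend only on the multiplication, so shrinking the carrier from GL_d to the
  lattice stabilizer just selects the cosets of its elements.\<close>

lemma \<Gamma>_stab_eq:
  "\<Gamma>_stab d ns = rcosets\<^bsub>(GL d)\<lparr>carrier := bounded_GL d ns\<rparr>\<^esub> (scalars d :: 'a::field poly mat set)"
proof -
  have "(PGL_act (PGL_poly_to_F d (scalars d #>\<^bsub>GL d\<^esub> g)) (lattice_class d (standard_lattice d ns)) =
      lattice_class d (standard_lattice d ns)) \<longleftrightarrow> g \<in> bounded_GL d ns"
    if "g \<in> carrier (GL d)" for g :: "'a poly mat"
    using that bounded_GL_iff(2)[OF that]
      coset_fixes_class_iff[of g d "\<lambda>i. fls_X_inv powi (ns ! i)"]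
    by (simp add: carrier_GL standard_lattice_eq)
  thus ?thesis
    using bounded_GL_subset
    unfolding \<Gamma>_stab_def vertex_stabilizer_def PGL_def FactGroup_def RCOSETS_def
    by (auto simp: r_coset_def subset_iff)
qed

lemma card_scalars: "card (scalars d :: 'a::{finite,field} poly mat set) = CARD('a) - 1"
proof -
  have "inj_on (\<lambda>c. [:c:] \<cdot>\<^sub>m 1\<^sub>m d) (- {0 :: 'a})"
  proof (rule inj_onI)
    fix x y :: 'a assume "[:x:] \<cdot>\<^sub>m 1\<^sub>m d = [:y:] \<cdot>\<^sub>m 1\<^sub>m d"
    from arg_cong[OF this, of "\<lambda>A. A $$ (0, 0)"] show "x = y" using d by simp
  qed
  thus ?thesis by (simp add: scalars_poly card_image card_Diff_singleton Compl_eq_Diff_UNIV)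
qed

text \<open>Lagrange's theorem for the scalars inside the lattice stabilizer.\<close>

lemma \<Gamma>_stab_card:
  assumes fin: "finite (bounded_GL d ns :: 'a::{finite,field} poly mat set)"
  shows "finite (\<Gamma>_stab d ns :: 'a poly mat set set)"
    and "card (\<Gamma>_stab d ns :: 'a poly mat set set) * (CARD('a) - 1) =
      card (bounded_GL d ns :: 'a poly mat set)"
proof -
  interpret G: group "GL d :: 'a poly mat monoid" by (rule group_GL)
  let ?H = "(GL d)\<lparr>carrier := bounded_GL d ns :: 'a poly mat set\<rparr>"
  interpret H: group ?H by (rule subgroup.subgroup_is_group[OF subgroup_bounded_GL group_GL])
  have "subgroup (scalars d) ?H"
    by (rule G.subgroup_incl[OF subgroup_scalars subgroup_bounded_GL scalars_subset])
  from H.lagrange[OF this] show "card (\<Gamma>_stab d ns :: 'a poly mat set set) * (CARD('a) - 1) =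
      card (bounded_GL d ns :: 'a poly mat set)"
    by (simp add: \<Gamma>_stab_eq card_scalars order_def)
  show "finite (\<Gamma>_stab d ns :: 'a poly mat set set)"
    unfolding \<Gamma>_stab_eq RCOSETS_def using fin by simp
qed

end

subsection \<open>Counting\<close>

lemma
  assumes "\<And>i j. i < m \<Longrightarrow> j < n \<Longrightarrow> finite (S i j)"
  defines "M \<equiv> {A \<in> carrier_mat m n. \<forall>i<m. \<forall>j<n. A $$ (i, j) \<in> S i j}"
  shows finite_matrices: "finite M"
    and card_matrices: "card M = (\<Prod>i<m. \<Prod>j<n. card (S i j))"
proof -
  let ?P = "PiE ({..<m} \<times> {..<n}) (\<lambda>(i, j). S i j)"
  have "bij_betw (mat m n) ?P M"
  proof (rule bij_betw_byWitness[where f' = "\<lambda>A. restrict (\<lambda>ij. A $$ ij) ({..<m} \<times> {..<n})"])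
    show "\<forall>f\<in>?P. restrict (\<lambda>ij. mat m n f $$ ij) ({..<m} \<times> {..<n}) = f"
      by (auto simp: fun_eq_iff PiE_def extensional_def)
    show "\<forall>A\<in>M. mat m n (restrict (\<lambda>ij. A $$ ij) ({..<m} \<times> {..<n})) = A"
      by (auto simp: M_def intro!: eq_matI)
    show "mat m n ` ?P \<subseteq> M" by (auto simp: M_def PiE_def Pi_def)
    show "(\<lambda>A. restrict (\<lambda>ij. A $$ ij) ({..<m} \<times> {..<n})) ` M \<subseteq> ?P"
      by (auto simp: M_def split: if_splits)
  qed
  moreover have "finite ?P" using assms(1) by (intro finite_PiE) auto
  moreover have "card ?P = (\<Prod>i<m. \<Prod>j<n. card (S i j))"
    by (simp add: card_PiE prod.cartesian_product case_prod_unfold)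
  ultimately show "finite M" "card M = (\<Prod>i<m. \<Prod>j<n. card (S i j))"
    using bij_betw_finite bij_betw_same_card by metis+
qed

lemma
  shows finite_degree_le: "finite {p :: 'a::{finite,zero} poly. degree p \<le> n}"
    and card_degree_le: "card {p :: 'a poly. degree p \<le> n} = CARD('a) ^ (n + 1)"
proof -
  have "finite {p :: 'a poly. degree p \<le> n} \<and> card {p :: 'a poly. degree p \<le> n} = CARD('a) ^ (n + 1)"
  proof (induction n)
    case 0
    have eq: "{p :: 'a poly. degree p \<le> 0} = (\<lambda>c. [:c:]) ` UNIV"
      by (auto elim: degree_eq_zeroE)
    have "inj (\<lambda>c :: 'a. [:c:])" by (auto intro: injI)
    thus ?case unfolding eq by (simp add: card_image)
  next
    case (Suc n)
    have eq: "{p :: 'a poly. degree p \<le> Suc n} = (\<lambda>(c, p). pCons c p) ` (UNIV \<times> {p. degree p \<le> n})"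
    proof (intro equalityI subsetI)
      fix p :: "'a poly" assume "p \<in> {p. degree p \<le> Suc n}"
      thus "p \<in> (\<lambda>(c, p). pCons c p) ` (UNIV \<times> {p. degree p \<le> n})"
        by (cases p) (auto simp: degree_pCons_eq_if split: if_splits)
    qed (auto simp: degree_pCons_eq_if)
    have "inj_on (\<lambda>(c :: 'a, p). pCons c p) (UNIV \<times> {p. degree p \<le> n})"
      by (auto intro!: inj_onI)
    thus ?case unfolding eq using Suc by (simp add: card_image card_cartesian_product)
  qed
  thus "finite {p :: 'a poly. degree p \<le> n}" "card {p :: 'a poly. degree p \<le> n} = CARD('a) ^ (n + 1)"
    by auto
qed

section \<open>Orders of the lattice stabilizers\<close>

lemma finite_bounded_GL: "finite (bounded_GL d ns :: 'a::{finite,field} poly mat set)"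
proof (rule finite_subset)
  let ?M = "{A :: 'a poly mat. A \<in> carrier_mat d d \<and>
      (\<forall>i<d. \<forall>j<d. A $$ (i, j) \<in> {p. degree p \<le> nat (ns ! i - ns ! j)})}"
  show "finite ?M" by (rule finite_matrices) (rule finite_degree_le)
  show "bounded_GL d ns \<subseteq> ?M"
  proof
    fix A :: "'a poly mat" assume A: "A \<in> bounded_GL d ns"
    have "degree (A $$ (i, j)) \<le> nat (ns ! i - ns ! j)" if "i < d" "j < d" for i j
    proof -
      have "A $$ (i, j) = 0 \<or> int (degree (A $$ (i, j))) \<le> ns ! i - ns ! j"
        using A that by (simp add: bounded_GL_def)
      thus ?thesis by (cases "A $$ (i, j) = 0") auto
    qed
    thus "A \<in> ?M" using A by (simp add: bounded_GL_def)
  qed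
qed

text \<open>Splitting off the last block of equal entries makes a matrix in the stabilizer block upper
  triangular, with a constant lower right block.\<close>

lemma card_bounded_GL_append:
  assumes len: "length ns = m" and nonneg: "\<And>x. x \<in> set ns \<Longrightarrow> 0 \<le> x" and gap: "0 < gap"
  shows "card (bounded_GL (m + k) (map (\<lambda>x. x + gap) ns @ replicate k 0) :: 'a::{finite,field} poly mat set) =
    card (bounded_GL m ns :: 'a poly mat set) * card (carrier (GL k :: 'a mat monoid)) *
    CARD('a) ^ (k * (\<Sum>x\<leftarrow>ns. nat (x + gap + 1)))"
proof -
  let ?ns = "map (\<lambda>x. x + gap) ns @ replicate k 0"
  let ?C = "\<lambda>c :: 'a. [:c:]"
  interpret C: comm_ring_hom ?C by unfold_locales (auto simp: one_pCons)
  \<comment> \<open>In the upper right block the bound n_i + gap is nonnegative, so the separate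
    zero case disappears and the entries can be counted freely.\<close>
  define B where "B = {A :: 'a poly mat. A \<in> carrier_mat m k \<and>
      (\<forall>i<m. \<forall>j<k. A $$ (i, j) \<in> {p. degree p \<le> nat (ns ! i + gap)})}"
  define S where "S = (bounded_GL m ns :: 'a poly mat set) \<times> B \<times> carrier (GL k :: 'a mat monoid)"
  define F where "F = (\<lambda>(P, Q, A). four_block_mat P Q (0\<^sub>m k m) (map_mat ?C A))"
  define G where "G = (\<lambda>g :: 'a poly mat. (mat m m (\<lambda>(i, j). g $$ (i, j)), mat m k (\<lambda>(i, j). g $$ (i, m + j)),
      mat k k (\<lambda>(i, j). coeff (g $$ (m + i, m + j)) 0)))"
  have nth: "?ns ! i = (if i < m then ns ! i + gap else 0)" if "i < m + k" for i
    using that len by (auto simp: nth_append)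
  have pos: "0 \<le> ns ! i" if "i < m" for i using that len nonneg by simp
  have det_F: "det (F (P, Q, A)) = det P * ?C (det A)"
    if "P \<in> carrier_mat m m" "Q \<in> carrier_mat m k" "A \<in> carrier_mat k k" for P Q A
    using that unfolding F_def
    by (simp add: det_four_block_mat_lower_left_zero[of _ m _ k] C.hom_det)
  have F_mem: "F (P, Q, A) \<in> bounded_GL (m + k) ?ns"
    if "P \<in> bounded_GL m ns" "Q \<in> B" "A \<in> carrier (GL k)" for P Q A
  proof -
    have c: "P \<in> carrier_mat m m" "Q \<in> carrier_mat m k" "A \<in> carrier_mat k k" "det P dvd 1" "det A \<noteq> 0"
      using that by (auto simp: bounded_GL_def B_def carrier_GL dvd_field_iff)
    have "F (P, Q, A) \<in> carrier_mat (m + k) (m + k)"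
      unfolding F_def using c by (simp add: four_block_carrier_mat)
    moreover have "det (F (P, Q, A)) dvd 1" using c by (auto simp: det_F)
    moreover have "F (P, Q, A) $$ (i, j) = 0 \<or> int (degree (F (P, Q, A) $$ (i, j))) \<le> ?ns ! i - ?ns ! j"
      if ij: "i < m + k" "j < m + k" for i j
      using that c \<open>P \<in> bounded_GL m ns\<close> \<open>Q \<in> B\<close> gap pos[of i]
      unfolding nth[OF ij(1)] nth[OF ij(2)]
      by (auto simp: F_def bounded_GL_def B_def le_nat_iff)
    ultimately show ?thesis unfolding bounded_GL_def by blast
  qed
  \<comment> \<open>In the lower left block the bound is -(n_j + gap) < 0 and forces zeros. In the
    lower right block it is 0 and forces constants, so \<open>G\<close> loses nothing by keeping
    only the constant coefficients there.\<close>
  have entries: "g \<in> carrier_mat (m + k) (m + k)" "det g dvd 1"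
      "\<And>i j. i < m \<Longrightarrow> j < m \<Longrightarrow> g $$ (i, j) = 0 \<or> int (degree (g $$ (i, j))) \<le> ns ! i - ns ! j"
      "\<And>i j. i < m \<Longrightarrow> j < k \<Longrightarrow> degree (g $$ (i, m + j)) \<le> nat (ns ! i + gap)"
      "\<And>i j. i < k \<Longrightarrow> j < m \<Longrightarrow> g $$ (m + i, j) = 0"
      "\<And>i j. i < k \<Longrightarrow> j < k \<Longrightarrow> g $$ (m + i, m + j) = ?C (coeff (g $$ (m + i, m + j)) 0)"
    if g: "g \<in> bounded_GL (m + k) ?ns" for g
  proof -
    show "g \<in> carrier_mat (m + k) (m + k)" "det g dvd 1" using g by (auto simp: bounded_GL_def)
    have *: "g $$ (i, j) = 0 \<or> int (degree (g $$ (i, j))) \<le> ?ns ! i - ?ns ! j"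
      if "i < m + k" "j < m + k" for i j using g that by (auto simp: bounded_GL_def)
    show "g $$ (i, j) = 0 \<or> int (degree (g $$ (i, j))) \<le> ns ! i - ns ! j" if "i < m" "j < m" for i j
      using *[of i j] that by (simp add: nth)
    show "degree (g $$ (i, m + j)) \<le> nat (ns ! i + gap)" if "i < m" "j < k" for i j
      using *[of i "m + j"] that by (auto simp: nth)
    show "g $$ (m + i, j) = 0" if "i < k" "j < m" for i j
      using *[of "m + i" j] that pos[of j] gap by (auto simp: nth)
    show "g $$ (m + i, m + j) = ?C (coeff (g $$ (m + i, m + j)) 0)" if "i < k" "j < k" for i j
      using *[of "m + i" "m + j"] that by (auto simp: nth elim!: degree_eq_zeroE)
  qed
  have FG: "F (G g) = g" if g: "g \<in> bounded_GL (m + k) ?ns" for g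
  proof (rule eq_matI)
    fix i j assume "i < dim_row g" "j < dim_col g"
    hence "i < m + k" "j < m + k" using entries(1)[OF g] by auto
    thus "F (G g) $$ (i, j) = g $$ (i, j)"
      using entries(5)[OF g, of "i - m" j] entries(6)[OF g, of "i - m" "j - m"]
      by (auto simp: F_def G_def)
  qed (use entries(1)[OF g] in \<open>auto simp: F_def G_def\<close>)
  have G_mem: "G g \<in> S" if g: "g \<in> bounded_GL (m + k) ?ns" for g
  proof -
    obtain P Q A where G: "G g = (P, Q, A)" by (cases "G g") auto
    have c: "P \<in> carrier_mat m m" "Q \<in> carrier_mat m k" "A \<in> carrier_mat k k"
      using G by (auto simp: G_def)
    \<comment> \<open>A product of polynomials is a unit only if both factors are, so the two
      diagonal blocks are invertible separately.\<close>
    have "det g = det P * ?C (det A)" using FG[OF g] det_F[OF c] by (simp add: G)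
    hence "det P dvd 1" "?C (det A) dvd 1" using entries(2)[OF g] by (metis is_unit_mult_iff)+
    hence "det P dvd 1" "det A dvd 1" by (auto simp: dvd_field_iff)
    moreover have "Q \<in> B" using entries(4)[OF g] G c by (auto simp: B_def G_def)
    moreover have "P $$ (i, j) = g $$ (i, j)" if "i < m" "j < m" for i j
      using that G by (auto simp: G_def)
    hence "P $$ (i, j) = 0 \<or> int (degree (P $$ (i, j))) \<le> ns ! i - ns ! j" if "i < m" "j < m" for i j
      using entries(3)[OF g that] that by simp
    ultimately show ?thesis
      using c unfolding G S_def bounded_GL_def carrier_GL by blast
  qed
  have "bij_betw F S (bounded_GL (m + k) ?ns)"
  proof (rule bij_betw_byWitness[where f' = G])
    show "\<forall>x\<in>S. G (F x) = x"
      by (auto simp: S_def F_def G_def bounded_GL_def B_def carrier_GL intro!: eq_matI)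
    show "F ` S \<subseteq> bounded_GL (m + k) ?ns" using F_mem by (auto simp: S_def)
  qed (use FG G_mem in auto)
  hence "card (bounded_GL (m + k) ?ns :: 'a poly mat set) = card S" by (simp add: bij_betw_same_card)
  also have "\<dots> = card (bounded_GL m ns :: 'a poly mat set) * card (carrier (GL k :: 'a mat monoid)) * card B"
    by (simp add: S_def card_cartesian_product)
  also have "card B = (\<Prod>i<m. \<Prod>j<k. card {p :: 'a poly. degree p \<le> nat (ns ! i + gap)})"
    unfolding B_def by (rule card_matrices) (rule finite_degree_le)
  also have "\<dots> = (\<Prod>i<m. CARD('a) ^ (k * (nat (ns ! i + gap) + 1)))"
    by (simp only: card_degree_le prod_constant card_lessThan power_mult[symmetric] mult.commute[of k])
  also have "\<dots> = CARD('a) ^ (k * (\<Sum>i<m. nat (ns ! i + gap) + 1))"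
    by (simp only: power_sum sum_distrib_left)
  \<comment> \<open>A degree bound e leaves e + 1 free coefficients, whence the added 1.\<close>
  also have "(\<Sum>i<m. nat (ns ! i + gap) + 1) = (\<Sum>x\<leftarrow>ns. nat (x + gap + 1))"
    unfolding sum_list_sum_nth using pos gap len
    by (auto simp: nat_add_distrib lessThan_atLeast0 intro!: sum.cong)
  finally show ?thesis .
qed

lemma card_bounded_GL_zero:
  "card (bounded_GL k (replicate k 0) :: 'a::{finite,field} poly mat set) = card (carrier (GL k :: 'a mat monoid))"
proof -
  \<comment> \<open>The only 0 by 0 matrix has determinant 1, so the empty list contributes a factor
    1. The gap 1 used below is an arbitrary positive choice.\<close>
  have "bounded_GL 0 [] = {0\<^sub>m 0 0 :: 'a poly mat}"
    by (auto simp: bounded_GL_def det_dim_zero intro!: eq_matI)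
  thus ?thesis using card_bounded_GL_append[of "[]" 0 1 k, where 'a = 'a] by simp
qed

subsection \<open>Summation over the sector\<close>

text \<open>Nonnegativity yields summability over the product from the iterated sums; the value then
  follows by summing over one factor at a time.\<close>

lemma has_sum_times_nonneg:
  fixes f :: "'a \<Rightarrow> real" and g :: "'b \<Rightarrow> real"
  assumes f: "(f has_sum S) A" "\<And>x. x \<in> A \<Longrightarrow> 0 \<le> f x" and g: "(g has_sum T) B" "\<And>x. x \<in> B \<Longrightarrow> 0 \<le> g x"
  shows "((\<lambda>(x, y). f x * g y) has_sum (S * T)) (A \<times> B)"
proof (rule has_sum_SigmaI)
  show inner: "((\<lambda>y. (\<lambda>(x, y). f x * g y) (x, y)) has_sum (f x * T)) B" if "x \<in> A" for x
    using has_sum_cmult_right[OF g(1), of "f x"] by simp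
  show outer: "((\<lambda>x. f x * T) has_sum (S * T)) A" by (rule has_sum_cmult_left[OF f(1)])
  show "(\<lambda>(x, y). f x * g y) summable_on A \<times> B"
    by (rule summable_on_SigmaI[OF inner has_sum_imp_summable[OF outer]]) (use f(2) g(2) in auto)
qed

text \<open>The series starts with the first power because the gap before the last block is at least
  1.\<close>

lemma has_sum_geometric_Suc:
  assumes "0 \<le> z" "z < (1 :: real)"
  shows "((\<lambda>n. z ^ Suc n) has_sum (z / (1 - z))) UNIV"
proof (rule sums_nonneg_imp_has_sum)
  have "(\<lambda>n. z * z ^ n) sums (z * (1 / (1 - z)))"
    using assms by (intro sums_mult geometric_sums) auto
  thus "(\<lambda>n. z ^ Suc n) sums (z / (1 - z))" by simp
qed (use assms in simp)

section \<open>Decomposition of the sector by the number of zeros\<close>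

text \<open>The gap is \<open>Suc n\<close>, so that positive gaps are parametrized by all natural
  numbers. It lifts the given entries above a new final block of \<open>k\<close> zeros.\<close>

definition prepend_gap :: "nat \<Rightarrow> int list \<times> nat \<Rightarrow> int list" where
  "prepend_gap k = (\<lambda>(ns, n). map (\<lambda>x. x + int (Suc n)) ns @ replicate k 0)"

lemma sector_indices_nonneg:
  assumes "ns \<in> sector_indices d" "x \<in> set ns"
  shows "0 \<le> x"
proof -
  from assms obtain i where i: "i < length ns" "x = ns ! i" by (metis in_set_conv_nth)
  have "ns \<noteq> []" using i by auto
  hence "ns ! (length ns - 1) = 0" using assms last_conv_nth by (fastforce simp: sector_indices_def)
  moreover have "ns ! (length ns - 1) \<le> ns ! i"
  proof (cases "i = length ns - 1")
    case False
    thus ?thesis using assms i unfolding sector_indices_def sorted_wrt_iff_nth_less by auto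
  qed simp
  ultimately show ?thesis using i by simp
qed

lemma nonincreasing_split_zeros:
  assumes "sorted_wrt (\<ge>) ns" "\<And>x. x \<in> set ns \<Longrightarrow> 0 \<le> (x :: int)"
  shows "ns = filter (\<lambda>x. 0 < x) ns @ replicate (count_list ns 0) 0"
  using assms
proof (induction ns)
  case (Cons x ns)
  show ?case
  proof (cases "x = 0")
    case True
    hence all: "y = 0" if "y \<in> set ns" for y using Cons.prems that by force
    hence "filter (\<lambda>x. 0 < x) ns = []" by (auto simp: filter_empty_conv)
    with Cons True show ?thesis by auto
  next
    case False
    hence "0 < x" using Cons.prems(2)[of x] by simp
    with Cons show ?thesis by auto
  qed
qed simp

text \<open>As \<open>ns\<close> ends in 0, its last lifted entry is the gap, and subtracting the
  gap recovers \<open>ns\<close>. A last entry exists because 0 < m.\<close>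

lemma inj_prepend_gap:
  assumes "0 < m"
  shows "inj_on (prepend_gap k) (sector_indices m \<times> UNIV)"
proof (rule inj_onI, clarify)
  fix ns n ns' n'
  assume ns: "ns \<in> sector_indices m" "ns' \<in> sector_indices m"
    and eq: "prepend_gap k (ns, n) = prepend_gap k (ns', n')"
  have len: "length ns = m" "length ns' = m" using ns by (auto simp: sector_indices_def)
  have map_eq: "map (\<lambda>x. x + int (Suc n)) ns = map (\<lambda>x. x + int (Suc n')) ns'"
    using eq len by (simp add: prepend_gap_def)
  have "ns \<noteq> []" "ns' \<noteq> []" using assms len by auto
  hence "last (map (\<lambda>x. x + int (Suc n)) ns) = int (Suc n)" "last (map (\<lambda>x. x + int (Suc n')) ns') = int (Suc n')"
    using ns by (simp_all add: last_map sector_indices_def)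
  hence n: "n = n'" using map_eq by simp
  moreover have "inj (\<lambda>x. x + int (Suc n'))" by (auto intro: injI)
  ultimately show "ns = ns' \<and> n = n'" using map_eq by (simp add: inj_map_eq_map)
qed

text \<open>The lifted entries are positive, so the number of zeros identifies \<open>k\<close>;
  this makes the pieces for different \<open>k\<close> disjoint.\<close>

lemma count_list_prepend_gap:
  assumes "ns \<in> sector_indices m"
  shows "count_list (prepend_gap k (ns, n)) 0 = k"
proof -
  have "0 \<notin> set (map (\<lambda>x. x + int (Suc n)) ns)"
    using sector_indices_nonneg[OF assms] by fastforce
  hence "count_list (map (\<lambda>x. x + int (Suc n)) ns) 0 = 0" by (simp add: count_list_0_iff)
  moreover have "count_list (replicate k (0 :: int)) 0 = k" by (induction k) auto
  ultimately show ?thesis by (simp add: prepend_gap_def)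
qed

text \<open>Here \<open>k\<close> is the number of zeros. If there are other entries, subtracting
  the smallest of them from all of them leaves a sector index of length d - k.\<close>

lemma sector_indices_decomp:
  assumes d: "0 < d"
  shows "sector_indices d =
    insert (replicate d 0) (\<Union>k\<in>{1..<d}. prepend_gap k ` (sector_indices (d - k) \<times> UNIV))"
proof (intro equalityI subsetI)
  fix ns assume ns: "ns \<in> sector_indices d"
  define k where "k = count_list ns 0"
  define A where "A = filter (\<lambda>x. 0 < x) ns"
  have split: "ns = A @ replicate k 0"
    unfolding A_def k_def
  proof (rule nonincreasing_split_zeros)
    show "sorted_wrt (\<ge>) ns" using ns by (simp add: sector_indices_def)
  qed (rule sector_indices_nonneg[OF ns])
  have S: "length ns = d" "sorted_wrt (\<ge>) ns" "last ns = 0" using ns by (auto simp: sector_indices_def)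
  have len: "length A + k = d" using arg_cong[OF split, of length] S(1) by simp
  have "ns \<noteq> []" "last ns = 0" using S d by auto
  hence "0 \<in> set ns" by (metis last_in_set)
  hence k: "1 \<le> k" by (metis k_def count_list_0_iff less_one not_le)
  show "ns \<in> insert (replicate d 0) (\<Union>k\<in>{1..<d}. prepend_gap k ` (sector_indices (d - k) \<times> UNIV))"
  proof (cases "A = []")
    case True
    thus ?thesis using split len by simp
  next
    case False
    hence "last A \<in> set A" by simp
    hence pos: "0 < last A" by (simp add: A_def)
    \<comment> \<open>\<open>last A\<close> is the smallest positive entry, hence the gap, and the
      encoding by \<open>Suc n\<close> asks for one less.\<close>
    define n where "n = nat (last A) - 1"
    have n: "int (Suc n) = last A" using pos by (simp add: n_def)
    define B where "B = map (\<lambda>x. x - last A) A"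
    have "sorted_wrt (\<ge>) A" using S(2) by (subst (asm) split) (simp add: sorted_wrt_append)
    hence "sorted_wrt (\<ge>) B" by (simp add: B_def sorted_wrt_map)
    moreover have "length B = d - k" using len by (simp add: B_def)
    moreover have "last B = 0" using False by (simp add: B_def last_map)
    ultimately have "B \<in> sector_indices (d - k)" by (simp add: sector_indices_def)
    moreover have "ns = prepend_gap k (B, n)"
      unfolding prepend_gap_def by (simp add: n B_def split comp_def del: of_nat_Suc)
    moreover have "k \<in> {1..<d}" using k len False by (cases A) auto
    ultimately show ?thesis by (intro insertI2 UN_I[of k] image_eqI[of _ _ "(B, n)"]) auto
  qed
next
  fix ns assume "ns \<in> insert (replicate d 0) (\<Union>k\<in>{1..<d}. prepend_gap k ` (sector_indices (d - k) \<times> UNIV))"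
  then consider "ns = replicate d 0"
    | k B n where "1 \<le> k" "k < d" "B \<in> sector_indices (d - k)" "ns = prepend_gap k (B, n)" by auto
  thus "ns \<in> sector_indices d"
  proof cases
    case 1
    thus ?thesis using d by (auto simp: sector_indices_def sorted_wrt_iff_nth_less)
  next
    case 2
    have B: "length B = d - k" "sorted_wrt (\<ge>) B" using 2 by (auto simp: sector_indices_def)
    have nonneg: "0 \<le> x" if "x \<in> set B" for x using 2(3) that by (rule sector_indices_nonneg)
    have "sorted_wrt (\<ge>) (replicate k (0 :: int))" by (simp add: sorted_wrt_iff_nth_less)
    moreover have "sorted_wrt (\<ge>) (map (\<lambda>x. x + int (Suc n)) B)" using B(2) by (simp add: sorted_wrt_map)
    moreover have "y \<le> x" if "x \<in> set (map (\<lambda>x. x + int (Suc n)) B)" "y \<in> set (replicate k 0)" for x y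
      using that nonneg by (auto simp: in_set_replicate intro: add_nonneg_nonneg)
    ultimately have "sorted_wrt (\<ge>) ns"
      unfolding 2(4) prepend_gap_def case_prod_conv sorted_wrt_append by blast
    moreover have "last ns = 0" "length ns = d"
      using 2(1,2) B(1) by (auto simp: 2(4) prepend_gap_def last_append)
    ultimately show ?thesis by (simp add: sector_indices_def)
  qed
qed

section \<open>Compositions and their terms\<close>

text \<open>Removing the last part matches removing the zero block from a sector index: the same
  values of \<open>k\<close> occur, with one exceptional element on each side.\<close>

lemma compositions_decomp:
  assumes d: "0 < d"
  shows "compositions d = insert [d] (\<Union>k\<in>{1..<d}. (\<lambda>ds. ds @ [k]) ` compositions (d - k))"
proof (intro equalityI subsetI)
  fix ds assume ds: "ds \<in> compositions d"
  hence "ds \<noteq> []" using d by (auto simp: compositions_def)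
  then obtain es k where es: "ds = es @ [k]" by (metis rev_exhaust)
  show "ds \<in> insert [d] (\<Union>k\<in>{1..<d}. (\<lambda>ds. ds @ [k]) ` compositions (d - k))"
  proof (cases "es = []")
    case True
    thus ?thesis using ds es by (auto simp: compositions_def)
  next
    case False
    have "0 < sum_list es" using False ds es by (cases es) (auto simp: compositions_def)
    hence "k \<in> {1..<d}" "es \<in> compositions (d - k)" using ds es by (auto simp: compositions_def)
    thus ?thesis using es by blast
  qed
qed (use d in \<open>auto simp: compositions_def\<close>)

lemma finite_compositions: "finite (compositions d)"
proof (rule finite_subset)
  show "finite {ds. set ds \<subseteq> {..d} \<and> length ds \<le> d}" by (rule finite_lists_length_le) simp
  show "compositions d \<subseteq> {ds. set ds \<subseteq> {..d} \<and> length ds \<le> d}"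
  proof
    fix ds assume ds: "ds \<in> compositions d"
    have "length ds \<le> sum_list ds" if "\<forall>k\<in>set ds. 0 < k" for ds :: "nat list"
      using that by (induction ds) auto
    moreover have "x \<le> sum_list ds" if "x \<in> set ds" for x using member_le_sum_list that by blast
    ultimately show "ds \<in> {ds. set ds \<subseteq> {..d} \<and> length ds \<le> d}" using ds by (auto simp: compositions_def)
  qed
qed

lemma sum_compositions:
  fixes f :: "nat list \<Rightarrow> real"
  assumes d: "0 < d"
  shows "(\<Sum>ds\<in>compositions d. f ds) = f [d] + (\<Sum>k=1..<d. \<Sum>ds\<in>compositions (d - k). f (ds @ [k]))"
proof -
  have "(\<Sum>ds\<in>compositions d. f ds) =
      f [d] + (\<Sum>ds\<in>(\<Union>k\<in>{1..<d}. (\<lambda>ds. ds @ [k]) ` compositions (d - k)). f ds)"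
    unfolding compositions_decomp[OF d]
    by (rule sum.insert) (simp add: finite_compositions, auto simp: compositions_def)
  also have "(\<Sum>ds\<in>(\<Union>k\<in>{1..<d}. (\<lambda>ds. ds @ [k]) ` compositions (d - k)). f ds) =
      (\<Sum>k=1..<d. \<Sum>ds\<in>(\<lambda>ds. ds @ [k]) ` compositions (d - k). f ds)"
    by (rule sum.UNION_disjoint) (auto simp: finite_compositions)
  also have "\<dots> = (\<Sum>k=1..<d. \<Sum>ds\<in>compositions (d - k). f (ds @ [k]))"
    by (simp add: sum.reindex inj_on_def)
  finally show ?thesis .
qed

text \<open>The parameter \<open>c\<close> stands for the total size of the blocks already split off on the right;
  for \<open>c = 0\<close> the exponents are the values of \<^const>\<open>cut_sum\<close>.\<close>

definition block_term :: "(nat \<Rightarrow> real) \<Rightarrow> real \<Rightarrow> nat \<Rightarrow> nat list \<Rightarrow> real" where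
  "block_term w y c ds =
     1 / (\<Prod>i<length ds. w (ds ! i)) * y ^ (\<Sum>j<length ds. \<Sum>i<j. ds ! i * ds ! j) *
     (\<Prod>l=1..<length ds.
        let x = y ^ (sum_list (take l ds) * (c + sum_list (drop l ds))) in x / (1 - x))"

lemma block_term_singleton: "block_term w y c [k] = 1 / w k"
  by (simp add: block_term_def)

text \<open>The new part adds k times \<open>sum_list ds\<close> to the sum over pairs. It lies to
  the right of every old cut, where passing from \<open>c\<close> to \<open>c + k\<close> absorbs
  it, and it creates one new cut directly before it, giving the factor in \<open>x\<close>. For
  empty \<open>ds\<close> there would be no such cut.\<close>

lemma block_term_snoc:
  fixes y :: real and c k :: nat
  assumes "ds \<noteq> []"
  defines "x \<equiv> y ^ (sum_list ds * (c + k))"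
  shows "block_term w y c (ds @ [k]) =
    block_term w y (c + k) ds * (1 / w k * y ^ (k * sum_list ds) * (x / (1 - x)))"
proof -
  let ?n = "length ds"
  have n: "1 \<le> ?n" using assms(1) by (cases ds) auto
  have e1: "(\<Prod>i<length (ds @ [k]). w ((ds @ [k]) ! i)) = (\<Prod>i<?n. w (ds ! i)) * w k"
    by (simp add: nth_append)
  have e2: "(\<Sum>j<length (ds @ [k]). \<Sum>i<j. (ds @ [k]) ! i * (ds @ [k]) ! j) =
      (\<Sum>j<?n. \<Sum>i<j. ds ! i * ds ! j) + k * sum_list ds"
    by (simp add: nth_append sum_list_sum_nth lessThan_atLeast0 sum_distrib_left mult.commute)
  have e3: "(\<Prod>l=1..<length (ds @ [k]).
        let x = y ^ (sum_list (take l (ds @ [k])) * (c + sum_list (drop l (ds @ [k])))) in x / (1 - x)) =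
      (\<Prod>l=1..<?n. let x = y ^ (sum_list (take l ds) * (c + k + sum_list (drop l ds))) in x / (1 - x)) *
      (x / (1 - x))"
    using assms(1) n by (simp add: prod.atLeastLessThan_Suc x_def add_ac Let_def)
  show ?thesis
    unfolding block_term_def e1 e2 e3 by (simp add: power_add mult_ac)
qed

lemma sum_list_nat_add:
  assumes "\<And>x. x \<in> set ns \<Longrightarrow> (0 :: int) \<le> x"
  shows "(\<Sum>x\<leftarrow>ns. nat (x + int a)) = (\<Sum>x\<leftarrow>ns. nat x) + length ns * a"
  using assms by (induction ns) (auto simp: nat_add_distrib)

text \<open>\<open>W\<close> enters only through nonnegativity, its value at zero lists and the gap
  rule, which separates the summation from the group theory. The induction on \<open>d\<close> is
  for all \<open>c\<close> at once, because removing a block of size \<open>k\<close> replaces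
  \<open>c\<close> by \<open>c + k\<close>.\<close>

lemma has_sum_sector_indices:
  fixes W :: "int list \<Rightarrow> real" and w :: "nat \<Rightarrow> real"
  assumes y: "0 \<le> y" "y < 1" and W: "\<And>ns. 0 \<le> W ns" and w: "\<And>k. 0 \<le> w k"
    and W_zero: "\<And>k. W (replicate k 0) = 1 / w k"
    and W_gap: "\<And>ns m k n. ns \<in> sector_indices m \<Longrightarrow>
      W (prepend_gap k (ns, n)) = W ns * (1 / w k * y ^ (k * (\<Sum>x\<leftarrow>ns. nat (x + int (n + 2)))))"
    and d: "0 < d"
  shows "((\<lambda>ns. W ns * y ^ (c * (\<Sum>x\<leftarrow>ns. nat x))) has_sum (\<Sum>ds\<in>compositions d. block_term w y c ds))
    (sector_indices d)"
  using d
proof (induction d arbitrary: c rule: less_induct)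
  case (less d)
  let ?N = "\<lambda>ns :: int list. \<Sum>x\<leftarrow>ns. nat x"
  let ?f = "\<lambda>ns. W ns * y ^ (c * ?N ns)"
  let ?R = "\<lambda>k ds. block_term w y c (ds @ [k])"
  have part: "(?f has_sum (\<Sum>ds\<in>compositions (d - k). ?R k ds)) (prepend_gap k ` (sector_indices (d - k) \<times> UNIV))"
    if k: "k \<in> {1..<d}" for k
  proof -
    define m where "m = d - k"
    have m: "m < d" "0 < m" using k by (auto simp: m_def)
    \<comment> \<open>Raising the gap by 1 raises each of the \<open>m\<close> earlier entries by 1,
      and each such unit costs y^k from the gap rule and y^c from the weight. The exponent is
      positive even for c = 0, since m and k are.\<close>
    define x where "x = y ^ (m * (c + k))"
    have x: "0 \<le> x" "x < 1" using y k m by (auto simp: x_def power_less_one_iff)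
    \<comment> \<open>The factor y^(k m) comes from the n + 2 in the gap rule, one more than the gap
      itself.\<close>
    define g where "g = (\<lambda>n. 1 / w k * y ^ (k * m) * x ^ Suc n)"
    have sum_m: "((\<lambda>ns. W ns * y ^ ((c + k) * ?N ns)) has_sum (\<Sum>ds\<in>compositions m. block_term w y (c + k) ds)) (sector_indices m)"
      by (rule less.IH[OF m])
    have sum_g: "(g has_sum (1 / w k * y ^ (k * m) * (x / (1 - x)))) UNIV"
      unfolding g_def by (intro has_sum_cmult_right has_sum_geometric_Suc x)
    have "((\<lambda>(ns, n). W ns * y ^ ((c + k) * ?N ns) * g n) has_sum
        ((\<Sum>ds\<in>compositions m. block_term w y (c + k) ds) * (1 / w k * y ^ (k * m) * (x / (1 - x)))))
        (sector_indices m \<times> UNIV)"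
      by (rule has_sum_times_nonneg[OF sum_m _ sum_g]) (use y x W w in \<open>auto simp: g_def\<close>)
    also have "(\<Sum>ds\<in>compositions m. block_term w y (c + k) ds) * (1 / w k * y ^ (k * m) * (x / (1 - x))) =
        (\<Sum>ds\<in>compositions m. ?R k ds)"
      unfolding sum_distrib_right
    proof (rule sum.cong)
      fix ds assume "ds \<in> compositions m"
      hence "ds \<noteq> []" "sum_list ds = m" using m by (auto simp: compositions_def)
      thus "block_term w y (c + k) ds * (1 / w k * y ^ (k * m) * (x / (1 - x))) = ?R k ds"
        by (simp add: block_term_snoc x_def)
    qed simp
    finally have "((\<lambda>(ns, n). W ns * y ^ ((c + k) * ?N ns) * g n) has_sum (\<Sum>ds\<in>compositions m. ?R k ds))
        (sector_indices m \<times> UNIV)" .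
    moreover have "(\<lambda>(ns, n). W ns * y ^ ((c + k) * ?N ns) * g n) (ns, n) = (?f \<circ> prepend_gap k) (ns, n)"
      if ns: "ns \<in> sector_indices m" for ns n
    proof -
      have len: "length ns = m" using ns by (simp add: sector_indices_def)
      have N2: "(\<Sum>x\<leftarrow>ns. nat (x + int (n + 2))) = ?N ns + m * (n + 2)"
        using sum_list_nat_add[of ns "n + 2"] sector_indices_nonneg[OF ns] len by blast
      have "?N (prepend_gap k (ns, n)) = (\<Sum>x\<leftarrow>ns. nat (x + int (Suc n)))"
        by (simp add: prepend_gap_def comp_def sum_list_replicate del: of_nat_Suc)
      also have "\<dots> = ?N ns + m * Suc n"
        using sum_list_nat_add[of ns "Suc n"] sector_indices_nonneg[OF ns] len by blast
      finally have N1: "?N (prepend_gap k (ns, n)) = ?N ns + m * Suc n" .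
      \<comment> \<open>The exponent splits into a part in \<open>ns\<close> and a part in
        \<open>n\<close>, which makes the summand a product.\<close>
      have "k * (?N ns + m * (n + 2)) + c * (?N ns + m * Suc n) =
          (c + k) * ?N ns + k * m + m * (c + k) * Suc n"
        by (simp add: algebra_simps)
      hence "y ^ (k * (?N ns + m * (n + 2)) + c * (?N ns + m * Suc n)) =
          y ^ ((c + k) * ?N ns + k * m + m * (c + k) * Suc n)"
        by (rule arg_cong)
      hence "y ^ (k * (?N ns + m * (n + 2))) * y ^ (c * (?N ns + m * Suc n)) =
          y ^ ((c + k) * ?N ns) * y ^ (k * m) * x ^ Suc n"
        unfolding x_def power_mult[of y "m * (c + k)" "Suc n", symmetric] power_add[symmetric] .
      thus ?thesis
        unfolding comp_def case_prod_conv W_gap[OF ns] N1 N2 g_def by (simp add: mult_ac)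
    qed
    ultimately have "((?f \<circ> prepend_gap k) has_sum (\<Sum>ds\<in>compositions m. ?R k ds)) (sector_indices m \<times> UNIV)"
      by (subst (asm) has_sum_cong) auto
    hence "(?f has_sum (\<Sum>ds\<in>compositions m. ?R k ds)) (prepend_gap k ` (sector_indices m \<times> UNIV))"
      by (simp only: has_sum_reindex[OF inj_prepend_gap[OF m(2)]])
    thus ?thesis by (simp only: m_def)
  qed
  have "(?f has_sum (\<Sum>k=1..<d. \<Sum>ds\<in>compositions (d - k). ?R k ds))
      (\<Union>k\<in>{1..<d}. prepend_gap k ` (sector_indices (d - k) \<times> UNIV))"
  proof (rule sum_has_sum[OF _ part])
    fix k k' :: nat assume "k \<in> {1..<d}" "k' \<in> {1..<d}" "k \<noteq> k'"
    note neq = this(3)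
    have cnt: "count_list ns 0 = j" if "ns \<in> prepend_gap j ` (sector_indices (d - j) \<times> UNIV)" for ns j
      using that count_list_prepend_gap by auto
    show "prepend_gap k ` (sector_indices (d - k) \<times> UNIV) \<inter> prepend_gap k' ` (sector_indices (d - k') \<times> UNIV) = {}"
    proof (rule ccontr)
      assume "\<not> ?thesis"
      then obtain ns where "ns \<in> prepend_gap k ` (sector_indices (d - k) \<times> UNIV)"
        "ns \<in> prepend_gap k' ` (sector_indices (d - k') \<times> UNIV)" by blast
      thus False using neq cnt by metis
    qed
  qed auto
  \<comment> \<open>The zero list has d zeros, while the elements of the pieces have k < d of
    them.\<close>
  moreover have "replicate d 0 \<notin> (\<Union>k\<in>{1..<d}. prepend_gap k ` (sector_indices (d - k) \<times> UNIV))"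
  proof
    assume "replicate d 0 \<in> (\<Union>k\<in>{1..<d}. prepend_gap k ` (sector_indices (d - k) \<times> UNIV))"
    then obtain k ns n where k: "k < d" "ns \<in> sector_indices (d - k)" "replicate d 0 = prepend_gap k (ns, n)"
      by auto
    have "count_list (replicate d (0 :: int)) 0 = d" by (induction d) auto
    thus False using k count_list_prepend_gap[OF k(2)] by simp
  qed
  ultimately have "(?f has_sum (?f (replicate d 0) + (\<Sum>k=1..<d. \<Sum>ds\<in>compositions (d - k). ?R k ds)))
      (insert (replicate d 0) (\<Union>k\<in>{1..<d}. prepend_gap k ` (sector_indices (d - k) \<times> UNIV)))"
    by (intro has_sum_insert)
  thus ?case
    unfolding sector_indices_decomp[OF less.prems] sum_compositions[OF less.prems]
    by (simp add: W_zero block_term_singleton sum_list_replicate)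
qed

section \<open>From block terms to the stated formula\<close>

lemma cut_sum_eq:
  assumes "l \<le> length ds"
  shows "cut_sum ds l = sum_list (take l ds) * sum_list (drop l ds)"
proof -
  have "sum_list (drop l ds) = (\<Sum>j<length ds - l. ds ! (l + j))"
    by (simp add: sum_list_sum_nth lessThan_atLeast0)
  also have "\<dots> = (\<Sum>j=l..<length ds. ds ! j)"
    using assms by (intro sum.reindex_bij_witness[of _ "\<lambda>j. j - l" "\<lambda>j. l + j"]) auto
  finally have "sum_list (drop l ds) = (\<Sum>j=l..<length ds. ds ! j)" .
  moreover have "sum_list (take l ds) = (\<Sum>i<l. ds ! i)"
    using assms by (simp add: sum_list_sum_nth lessThan_atLeast0)
  ultimately show ?thesis by (simp add: cut_sum_def sum_product)
qed

lemma powi_minus_int: "x powi (- int n) = (1 / x :: real) ^ n"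
  by (simp add: power_int_minus power_divide inverse_eq_divide)

text \<open>The quotient x / (1 - x) is rewritten with both signs changed, and powers of 1/q become
  negative powers of q.\<close>

lemma block_term_eq:
  "block_term w (1 / q) 0 ds =
     1 / (\<Prod>i<length ds. w (ds ! i)) * q powi (- int (\<Sum>j<length ds. \<Sum>i<j. ds ! i * ds ! j)) *
     (\<Prod>l=1..<length ds. - (q powi (- int (cut_sum ds l))) / (q powi (- int (cut_sum ds l)) - 1))"
proof -
  have "(\<Prod>l=1..<length ds. let x = (1 / q) ^ (sum_list (take l ds) * (0 + sum_list (drop l ds))) in x / (1 - x)) =
      (\<Prod>l=1..<length ds. - (q powi (- int (cut_sum ds l))) / (q powi (- int (cut_sum ds l)) - 1))"
  proof (rule prod.cong)
    fix l assume "l \<in> {1..<length ds}"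
    hence "cut_sum ds l = sum_list (take l ds) * (0 + sum_list (drop l ds))" by (simp add: cut_sum_eq)
    thus "(let x = (1 / q) ^ (sum_list (take l ds) * (0 + sum_list (drop l ds))) in x / (1 - x)) =
        - (q powi (- int (cut_sum ds l))) / (q powi (- int (cut_sum ds l)) - 1)"
      using minus_divide_divide[of "(1 / q) ^ cut_sum ds l" "1 - (1 / q) ^ cut_sum ds l"]
      unfolding powi_minus_int Let_def by simp
  qed simp
  thus ?thesis unfolding block_term_def powi_minus_int by simp
qed

theorem mainTheorem2:
  fixes d q :: nat
  assumes "d \<ge> 2" and "q = CARD('a::{finite,field})"
  shows
    "(\<forall>ns\<in>sector_indices d. finite (\<Gamma>_stab d ns :: 'a poly mat set set)) \<and>
     (\<lambda>ns. 1 / real (card (\<Gamma>_stab d ns :: 'a poly mat set set))) summable_on sector_indices d \<and>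
     (\<Sum>\<^sub>\<infinity>ns\<in>sector_indices d. 1 / real (card (\<Gamma>_stab d ns :: 'a poly mat set set))) =
       (real q - 1) *
       (\<Sum>ds\<in>compositions d.
          1 / (\<Prod>i<length ds. real (card (carrier (GL (ds ! i) :: 'a mat monoid)))) *
          real q powi (- int (\<Sum>j<length ds. \<Sum>i<j. ds ! i * ds ! j)) *
          (\<Prod>l=1..<length ds.
             - (real q powi (- int (cut_sum ds l))) /
             (real q powi (- int (cut_sum ds l)) - 1)))"
proof -
  have d: "0 < d" using assms(1) by simp
  have "{0, 1} \<subseteq> (UNIV :: 'a set)" by simp
  hence "card {0, 1 :: 'a} \<le> q" unfolding assms(2) by (intro card_mono) auto
  hence q: "2 \<le> q" by simp
  define y where "y = 1 / real q"
  have y: "0 \<le> y" "y < 1" using q by (auto simp: y_def)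
  \<comment> \<open>\<open>W\<close> uses the stabilizer in GL_d; the factor q - 1 for the scalars
    is put back at the end.\<close>
  define W where "W = (\<lambda>ns. 1 / real (card (bounded_GL (length ns) ns :: 'a poly mat set)))"
  define w where "w = (\<lambda>k. real (card (carrier (GL k :: 'a mat monoid))))"
  have W_gap: "W (prepend_gap k (ns, n)) = W ns * (1 / w k * y ^ (k * (\<Sum>x\<leftarrow>ns. nat (x + int (n + 2)))))"
    if ns: "ns \<in> sector_indices m" for ns m k n
  proof -
    have len: "length ns = m" using ns by (simp add: sector_indices_def)
    have "(\<Sum>x\<leftarrow>ns. nat (x + int (Suc n) + 1)) = (\<Sum>x\<leftarrow>ns. nat (x + int (n + 2)))"
      by (simp add: add_ac)
    hence "card (bounded_GL (m + k) (prepend_gap k (ns, n)) :: 'a poly mat set) =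
        card (bounded_GL m ns :: 'a poly mat set) * card (carrier (GL k :: 'a mat monoid)) *
        q ^ (k * (\<Sum>x\<leftarrow>ns. nat (x + int (n + 2))))"
      using card_bounded_GL_append[OF len sector_indices_nonneg[OF ns], of "int (Suc n)" k, where 'a = 'a]
      unfolding prepend_gap_def case_prod_conv assms(2) by simp
    moreover have "length (prepend_gap k (ns, n)) = m + k" using len by (simp add: prepend_gap_def)
    ultimately show ?thesis using len by (simp add: W_def w_def y_def power_divide)
  qed
  \<comment> \<open>For c = 0 the additional weight is y^0 = 1, so this is the plain sum of
    \<open>W\<close>.\<close>
  have "((\<lambda>ns. W ns * y ^ (0 * (\<Sum>x\<leftarrow>ns. nat x))) has_sum (\<Sum>ds\<in>compositions d. block_term w y 0 ds))
      (sector_indices d)"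
    by (rule has_sum_sector_indices[OF y _ _ _ W_gap d])
       (auto simp: W_def w_def card_bounded_GL_zero)
  hence "((\<lambda>ns. (real q - 1) * W ns) has_sum ((real q - 1) * (\<Sum>ds\<in>compositions d. block_term w y 0 ds)))
      (sector_indices d)"
    by (intro has_sum_cmult_right) simp
  moreover have "(real q - 1) * W ns = 1 / real (card (\<Gamma>_stab d ns :: 'a poly mat set set))"
    if ns: "ns \<in> sector_indices d" for ns
  proof -
    have "length ns = d" using ns by (simp add: sector_indices_def)
    moreover have "real (card (\<Gamma>_stab d ns :: 'a poly mat set set)) * (real q - 1) =
        real (card (bounded_GL d ns :: 'a poly mat set))"
      using arg_cong[OF \<Gamma>_stab_card(2)[OF d finite_bounded_GL, of ns, where 'a = 'a], of real] q
      by (simp add: assms(2) of_nat_diff)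
    moreover have "real q - 1 \<noteq> 0" using q by simp
    ultimately have "W ns = 1 / (real (card (\<Gamma>_stab d ns :: 'a poly mat set set)) * (real q - 1))"
      by (simp only: W_def)
    with \<open>real q - 1 \<noteq> 0\<close> show ?thesis by simp
  qed
  ultimately have "((\<lambda>ns. 1 / real (card (\<Gamma>_stab d ns :: 'a poly mat set set))) has_sum
      ((real q - 1) * (\<Sum>ds\<in>compositions d. block_term w y 0 ds))) (sector_indices d)"
    by (subst (asm) has_sum_cong) auto
  hence sum: "(\<lambda>ns. 1 / real (card (\<Gamma>_stab d ns :: 'a poly mat set set))) summable_on sector_indices d"
    "(\<Sum>\<^sub>\<infinity>ns\<in>sector_indices d. 1 / real (card (\<Gamma>_stab d ns :: 'a poly mat set set))) =
      (real q - 1) * (\<Sum>ds\<in>compositions d. block_term w y 0 ds)"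
    by (simp_all add: has_sum_iff)
  show ?thesis
    using sum \<Gamma>_stab_card(1)[OF d finite_bounded_GL] unfolding y_def block_term_eq w_def
    by (intro conjI ballI)
qed

end
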